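(* Let $\mathcal{S}$ be a quantum stochastic source consisting of an alphabet of $N$ pure states $\ket{s_1},\dots,\ket{s_N}$ spanning a $d$-dimensional Hilbert space $\mathcal{H}$ and a stochastic process $X$ with mass function $p$. Fix positive integers $m,l$. For each $k\in\{1,\dots,m\}$ and each $(n_1,\dots,n_{(k-1)l})\in\{1,\dots,N\}^{(k-1)l}$ let $(\lambda_i^{n_1,\dots,n_{(k-1)l}})_{i=1}^{d^l}$ be the eigenvalues (with multiplicity, in decreasing order) of the $k$-th block conditional ensemble state $\rho^{n_1,\dots,n_{(k-1)l}}$, and let $(\ket{\lambda_i^{n_1,\dots,n_{(k-1)l}}})_{i=1}^{d^l}$ be a corresponding orthonormal basis of eigenvectors (for $k=1$ these are written $\lambda_i$, $\ket{\lambda_i}$ and refer to $\rho_l$). Let $$\mathfrak{L}=\Big\{(\ell_1,\dots,\ell_{d^l}) : \ell_i\in\mathbb{N}\cup\{0\}\text{ for all } i,\ \ell_1\le\ell_2\le\cdots\le\ell_{d^l},\ \sum_{i=1}^{d^l}2^{-\ell_i}\le 1\Big\}$$ and define $\mathcal{F}_{\mathcal S}:\mathfrak{L}\to[0,\infty)$ by $$\mathcal{F}_{\mathcal S}((\ell_i)_{i=1}^{d^l})=\sum_{j=2}^{m}\Big(\sum_{n_1,\dots,n_{(j-1)l}=1}^{N}p(n_1,\dots,n_{(j-1)l})\sum_{i=1}^{d^l}\lambda_i^{n_1,\dots,n_{(j-1)l}}\,\ell_i\Big)+\sum_{i=1}^{d^l}\lambda_i\ell_i .$$ Then: (1) $\mathcal{F}_{\mathcal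 S}$ attains its minimum on $\mathfrak{L}$ and $$ILS(\mathcal{S},m,l)=\min\{\mathcal{F}_{\mathcal S}((\ell_i)_{i=1}^{d^l}) : (\ell_i)_{i=1}^{d^l}\in\mathfrak{L}\}.$$ (2) The infimum defining $ILS(\mathcal{S},m,l)$ is a minimum: there is a special block code $\mathcal{V}$ with $L(\mathcal{V})=\min_{\mathfrak{L}}\mathcal{F}_{\mathcal S}$. Explicitly, if $\mathcal{F}_{\mathcal S}$ attains its minimum at $(\ell_i)_{i=1}^{d^l}\in\mathfrak{L}$, then there exists a sequence $(\omega_i)_{i=1}^{d^l}$ of classical bit strings, with $\omega_i$ of length $\ell_i$, forming the image of a classical uniquely decodable code; for such a sequence the qubit strings $(\ket{\omega_i})_{i=1}^{d^l}$ form a jointly orthonormal sequence of length codewords, and the family $\mathcal{V}=\{V^{n_1,\dots,n_{(k-1)l}} : 1\le k\le m,\ n_1,\dots,n_{(k-1)l}\in\{1,\dots,N\}\}$ of maps $V^{n_1,\dots,n_{(k-1)l}}:\mathcal{H}^{\otimes l}\to(\mathbb{C}^2)^{\oplus}$, $$V^{n_1,\dots,n_{(k-1)l}}=\sum_{i=1}^{d^l}\ket{\omega_i}\bra{\lambda_i^{n_1,\dots,n_{(k-1)l}}},$$ is a special block code with $L(\mathcal{V})=\min_{\mathfrak{L}}\mathcal{F}_{\mathcal S}$.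
   Context: Pure states are unit vectors. $\mathbb{N}=\{1,2,\dots\}$. Quantum stochastic source: a finite list of pure states $\ket{s_1},\dots,\ket{s_N}$ spanning a $d$-dimensional Hilbert space $\mathcal{H}$ together with a stochastic process $X=(X_n)_{n\ge1}$ with values in $\{1,\dots,N\}$; at time $n$ the state $\ket{s_{X_n}}$ is emitted. Its mass function is $p(n_1,\dots,n_q)=\mathbb{P}(X_1=n_1,\dots,X_q=n_q)$. Write $\ket{s_{n_1}\cdots s_{n_q}}=\ket{s_{n_1}}\otimes\cdots\otimes\ket{s_{n_q}}$. The ensemble state of $q$ emissions is $\rho_q=\sum_{n_1,\dots,n_q=1}^N p(n_1,\dots,n_q)\ket{s_{n_1}\cdots s_{n_q}}\bra{s_{n_1}\cdots s_{n_q}}$. $k$-th block conditional ensemble state (block size $l$): $$\rho^{n_1,\dots,n_{(k-1)l}}=\sum_{n_{(k-1)l+1},\dots,n_{kl}=1}^N\frac{p(n_1,\dots,n_{kl})}{p(n_1,\dots,n_{(k-1)l})}\ket{s_{n_{(k-1)l+1}}\cdots s_{n_{kl}}}\bra{s_{n_{(k-1)l+1}}\cdots s_{n_{kl}}}.$$ For $k=1$ the index string is empty, the state is $\rho_l$, and the prefactor $p$ of the empty string is $1$. If $p(n_1,\dots,n_{(k-1)l})=0$, $\rho^{n_1,\dots,n_{(k-1)l}}$ is taken to be an arbitrary density operator on $\mathcal{H}^{\otimes l}$ (it only enters with weight $0$). Fock space: $(\mathbb{C}^2)^{\oplus}=\bigoplus_{k=0}^\infty(\mathbb{C}^2)^{\otimes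 k}$ with $(\mathbb{C}^2)^{\otimes0}=\mathbb{C}$; its standard basis is the set of qubit strings $\ket{\omega}$, $\omega$ a finite bit string (including the empty string). A length codeword (length state) of length $\ell$ is a unit vector in $(\mathbb{C}^2)^{\otimes\ell}$ for some integer $\ell\ge 0$. Concatenation $\circ$ is defined on standard basis vectors by concatenating bit strings and extended multilinearly. A sequence of unit vectors $(\ket{\psi_i})_{i=1}^D$ in $(\mathbb{C}^2)^{\oplus}$ is jointly orthonormal if for every $M\in\mathbb{N}$ the family $\ket{\psi_{v_1}\circ\cdots\circ\psi_{v_M}}$, indexed by $(v_1,\dots,v_M)\in\{1,\dots,D\}^M$, is orthonormal (distinct index tuples give orthogonal vectors). A classical code with image $(\omega_i)_{i=1}^D$ is uniquely decodable if the extension of $i\mapsto\omega_i$ to finite strings of indices by concatenation is one-to-one. Special block code (for $\mathcal{S},m,l$): a family of isometries $\mathcal{U}=\{U^{n_1,\dots,n_{(k-1)l}}:1\le k\le m,\ n_1,\dots,n_{(k-1)l}\in\{1,\dots,N\}\}$ from $\mathcal{H}^{\otimes l}$ to $(\mathbb{C}^2)^{\oplus}$ for which there are a single jointly orthonormal sequence of length codewords $(\ket{\psi_i})_{i=1}^{d^l}$ and orthonormal bases $(\ket{e_i^{n_1,\dots,n_{(k-1)l}}})_{i=1}^{d^l}$ of $\mathcal{H}^{\otimes l}$ with $U^{n_1,\dots,n_{(k-1)l}}=\sum_{i=1}^{d^l}\ket{\psi_i}\bra{e_i^{n_1,\dots,n_{(k-1)l}}}$. For $k=1$ the isometry is written $U$.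 Length observable: $\Lambda=\sum_{\ell=0}^\infty\ell\,\Pi_\ell$, with $\Pi_\ell$ the orthogonal projection of $(\mathbb{C}^2)^{\oplus}$ onto $(\mathbb{C}^2)^{\otimes\ell}$. Average codeword length of $\mathcal{U}$: $$L(\mathcal{U})=\sum_{n_1,\dots,n_{ml}=1}^N p(n_1,\dots,n_{ml})\,\mathrm{Tr}\big(\ket{x_{n_1,\dots,n_{ml}}}\bra{x_{n_1,\dots,n_{ml}}}\Lambda\big),$$ where $x_{n_1,\dots,n_{ml}}=U\ket{s_{n_1}\cdots s_{n_l}}\circ U^{n_1,\dots,n_l}\ket{s_{n_{l+1}}\cdots s_{n_{2l}}}\circ\cdots\circ U^{n_1,\dots,n_{(m-1)l}}\ket{s_{n_{(m-1)l+1}}\cdots s_{n_{ml}}}$. $ILS(\mathcal{S},m,l)$ is the infimum of $L(\mathcal{U})$ over all special block codes $\mathcal{U}$ for $\mathcal{S},m,l$.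
   Formalization: For d = 1 the minimizing length is 0 and the empty word is not the image of a uniquely decodable code, so unique decodability of (ω_i) is asserted and required only for d ≥ 2; for d = 1 only the lengths of the ω_i are prescribed. *)

theory Defs
  imports "HOL-Probability.Probability"
begin

section \<open>Tensor powers and Fock spaces in the standard basis\<close>

text \<open>
  A vector is given by its amplitudes with respect to the standard basis of words over an
  alphabet \<open>'a\<close>: the vectors supported on words of length \<open>k\<close> form the \<open>k\<close>-th tensor power of the
  Hilbert space with orthonormal basis \<open>'a\<close>, and the square-summable amplitude functions on all
  words form the Hilbert direct sum of these powers.  We use \<open>'a = 'd\<close> for the source space
  \<open>complex ^ 'd\<close> of dimension \<open>CARD('d)\<close>, and \<open>'a = bool\<close> for qubit strings.
\<close>

type_synonym 'a ampl = "'a list \<Rightarrow> complex"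

definition tpow :: "nat \<Rightarrow> 'a ampl set" where
  "tpow k = {v. \<forall>w. length w \<noteq> k \<longrightarrow> v w = 0}"

definition fock :: "'a ampl set" where
  "fock = {v. (\<lambda>w. (cmod (v w))\<^sup>2) summable_on UNIV}"

definition ket :: "'a list \<Rightarrow> 'a ampl" where
  "ket u = (\<lambda>w. if w = u then 1 else 0)"

definition ip :: "'a ampl \<Rightarrow> 'a ampl \<Rightarrow> complex" where
  "ip x y = (\<Sum>\<^sub>\<infinity>w. cnj (x w) * y w)"

definition ketbra :: "'a ampl \<Rightarrow> 'b ampl \<Rightarrow> 'b ampl \<Rightarrow> 'a ampl" where
  "ketbra x y = (\<lambda>v w. ip y v * x w)"

text \<open>The trace with respect to the basis words in \<open>B\<close>.\<close>

definition trace_on :: "'a list set \<Rightarrow> ('a ampl \<Rightarrow> 'a ampl) \<Rightarrow> complex" where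
  "trace_on B A = (\<Sum>\<^sub>\<infinity>u\<in>B. ip (ket u) (A (ket u)))"

definition orthonormal_on :: "'i set \<Rightarrow> ('i \<Rightarrow> 'a ampl) \<Rightarrow> bool" where
  "orthonormal_on I e \<longleftrightarrow> (\<forall>i\<in>I. \<forall>j\<in>I. ip (e i) (e j) = (if i = j then 1 else 0))"

definition onb :: "nat \<Rightarrow> nat \<Rightarrow> (nat \<Rightarrow> 'a ampl) \<Rightarrow> bool" where
  "onb l D e \<longleftrightarrow> (\<forall>i\<in>{1..D}. e i \<in> tpow l) \<and> orthonormal_on {1..D} e \<and>
     (\<forall>v\<in>tpow l. \<exists>c. v = (\<lambda>w. \<Sum>i=1..D. c i * e i w))"

text \<open>Operators on a tensor power are functions of which only the values on \<open>tpow l\<close> matter.\<close>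

definition linear_on_tpow :: "nat \<Rightarrow> ('a ampl \<Rightarrow> 'b ampl) \<Rightarrow> bool" where
  "linear_on_tpow l A \<longleftrightarrow> (\<forall>u\<in>tpow l. \<forall>v\<in>tpow l. \<forall>a b.
     A (\<lambda>w. a * u w + b * v w) = (\<lambda>w. a * A u w + b * A v w))"

definition fock_isometry :: "nat \<Rightarrow> ('a ampl \<Rightarrow> 'b ampl) \<Rightarrow> bool" where
  "fock_isometry l V \<longleftrightarrow> linear_on_tpow l V \<and> (\<forall>v\<in>tpow l. V v \<in> fock) \<and>
     (\<forall>u\<in>tpow l. \<forall>v\<in>tpow l. ip (V u) (V v) = ip u v)"

definition density_operator :: "nat \<Rightarrow> ('a ampl \<Rightarrow> 'a ampl) \<Rightarrow> bool" where
  "density_operator l A \<longleftrightarrow> linear_on_tpow l A \<and>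
     (\<forall>v\<in>tpow l. A v \<in> tpow l \<and> ip v (A v) \<in> \<real>\<^sub>\<ge>\<^sub>0) \<and>
     trace_on {u. length u = l} A = 1"

text \<open>
  Since \<open>e\<close> is an orthonormal basis of eigenvectors, every eigenvalue of \<open>A\<close> occurs in \<open>lam\<close> as
  often as the dimension of its eigenspace.
\<close>

definition eigensystem ::
  "nat \<Rightarrow> nat \<Rightarrow> ('a ampl \<Rightarrow> 'a ampl) \<Rightarrow> (nat \<Rightarrow> real) \<Rightarrow> (nat \<Rightarrow> 'a ampl) \<Rightarrow> bool" where
  "eigensystem l D A lam e \<longleftrightarrow> onb l D e \<and> antimono_on {1..D} lam \<and>
     (\<forall>i\<in>{1..D}. A (e i) = (\<lambda>w. of_real (lam i) * e i w))"

section \<open>Sources\<close>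

definition words :: "nat \<Rightarrow> nat \<Rightarrow> nat list set" where
  "words N q = {ns. length ns = q \<and> set ns \<subseteq> {1..N}}"

definition quantum_source ::
  "nat \<Rightarrow> (nat \<Rightarrow> complex ^ 'd) \<Rightarrow> 'w measure \<Rightarrow> (nat \<Rightarrow> 'w \<Rightarrow> nat) \<Rightarrow> bool" where
  "quantum_source N s M X \<longleftrightarrow>
     (\<forall>n\<in>{1..N}. norm (s n) = 1) \<and> vec.span (s ` {1..N}) = UNIV \<and>
     prob_space M \<and> (\<forall>t\<ge>1. X t \<in> measurable M (count_space {1..N}))"

text \<open>List positions start at 0, time starts at 1.\<close>

definition mass :: "'w measure \<Rightarrow> (nat \<Rightarrow> 'w \<Rightarrow> nat) \<Rightarrow> nat list \<Rightarrow> real" where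
  "mass M X ns = measure M {x \<in> space M. \<forall>i<length ns. X (Suc i) x = ns ! i}"

definition prod_state :: "(nat \<Rightarrow> complex ^ 'd) \<Rightarrow> nat list \<Rightarrow> 'd ampl" where
  "prod_state s ns = (\<lambda>w. if length w = length ns
     then \<Prod>i<length ns. s (ns ! i) $ (w ! i) else 0)"

definition ensemble_state ::
  "nat \<Rightarrow> (nat \<Rightarrow> complex ^ 'd) \<Rightarrow> (nat list \<Rightarrow> real) \<Rightarrow> nat \<Rightarrow> 'd ampl \<Rightarrow> 'd ampl" where
  "ensemble_state N s p q = (\<lambda>v w. \<Sum>ns\<in>words N q.
     of_real (p ns) * ketbra (prod_state s ns) (prod_state s ns) v w)"

definition block_cond_state ::
  "nat \<Rightarrow> (nat \<Rightarrow> complex ^ 'd) \<Rightarrow> (nat list \<Rightarrow> real) \<Rightarrow> nat \<Rightarrow> nat list \<Rightarrow> 'd ampl \<Rightarrow> 'd ampl" where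
  "block_cond_state N s p l h = (\<lambda>v w. \<Sum>ns\<in>words N l.
     of_real (p (h @ ns) / p h) * ketbra (prod_state s ns) (prod_state s ns) v w)"

text \<open>The empty history gives the ensemble state.\<close>

lemma mass_Nil: "prob_space M \<Longrightarrow> mass M X [] = 1"
  by (simp add: mass_def prob_space.prob_space)

lemma block_cond_state_Nil:
  "prob_space M \<Longrightarrow> block_cond_state N s (mass M X) l [] = ensemble_state N s (mass M X) l"
  by (simp add: block_cond_state_def ensemble_state_def mass_Nil)

text \<open>The index strings of the blocks \<open>1, \<dots>, m\<close>.\<close>

definition histories :: "nat \<Rightarrow> nat \<Rightarrow> nat \<Rightarrow> nat list set" where
  "histories N m l = (\<Union>k\<in>{1..m}. words N ((k - 1) * l))"

text \<open>
  A choice of the block conditional ensemble states; on histories of probability 0 it is an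
  arbitrary density operator.
\<close>

definition block_cond_states ::
  "nat \<Rightarrow> (nat \<Rightarrow> complex ^ 'd) \<Rightarrow> (nat list \<Rightarrow> real) \<Rightarrow> nat \<Rightarrow> nat \<Rightarrow>
   (nat list \<Rightarrow> 'd ampl \<Rightarrow> 'd ampl) \<Rightarrow> bool" where
  "block_cond_states N s p m l R \<longleftrightarrow> (\<forall>h\<in>histories N m l.
     if p h = 0 then density_operator l (R h)
     else (\<forall>v\<in>tpow l. R h v = block_cond_state N s p l h v))"

section \<open>Codes\<close>

text \<open>
  The multilinear extension of the concatenation of words:
  \<open>ket u \<circ> ket v = ket (u @ v)\<close>, so the amplitude at \<open>w\<close> sums over all splittings of \<open>w\<close>.
\<close>

definition cat :: "bool ampl \<Rightarrow> bool ampl \<Rightarrow> bool ampl" where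
  "cat x y = (\<lambda>w. \<Sum>(u, v)\<in>{(u, v). u @ v = w}. x u * y v)"

lemma cat_ket: "cat (ket u) (ket v) = ket (u @ v)"
proof
  fix w :: "bool list"
  have "finite ((\<lambda>i. (take i w, drop i w)) ` {..length w})" by simp
  moreover have "{(a, b). a @ b = w} \<subseteq> (\<lambda>i. (take i w, drop i w)) ` {..length w}"
  proof clarify
    fix a b :: "bool list"
    show "(a, b) \<in> (\<lambda>i. (take i (a @ b), drop i (a @ b))) ` {..length (a @ b)}"
      by (rule image_eqI[of _ _ "length a"]) auto
  qed
  ultimately have fin: "finite {(a, b). a @ b = w}" by (rule finite_subset[rotated])
  have "cat (ket u) (ket v) w = (\<Sum>q\<in>{(a, b). a @ b = w}. if q = (u, v) then 1 else 0)"
    unfolding cat_def ket_def by (rule sum.cong) (auto split: if_splits)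
  also have "\<dots> = ket (u @ v) w" using fin by (simp add: ket_def eq_commute)
  finally show "cat (ket u) (ket v) w = ket (u @ v) w" .
qed

definition cats :: "bool ampl list \<Rightarrow> bool ampl" where
  "cats xs = foldr cat xs (ket [])"

definition length_codeword :: "nat \<Rightarrow> bool ampl \<Rightarrow> bool" where
  "length_codeword k x \<longleftrightarrow> x \<in> tpow k \<and> ip x x = 1"

definition jointly_orthonormal :: "nat \<Rightarrow> (nat \<Rightarrow> bool ampl) \<Rightarrow> bool" where
  "jointly_orthonormal D \<psi> \<longleftrightarrow> (\<forall>i\<in>{1..D}. \<psi> i \<in> fock \<and> ip (\<psi> i) (\<psi> i) = 1) \<and>
     (\<forall>M\<ge>1. orthonormal_on (words D M) (\<lambda>v. cats (map \<psi> v)))"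

text \<open>
  The empty word alone (\<open>D = 1\<close>) is not uniquely decodable: all strings of indices have the same
  image.
\<close>

definition uniquely_decodable :: "nat \<Rightarrow> (nat \<Rightarrow> bool list) \<Rightarrow> bool" where
  "uniquely_decodable D \<omega> \<longleftrightarrow> inj_on (\<lambda>v. concat (map \<omega> v)) (lists {1..D})"

definition code_op :: "nat \<Rightarrow> (nat \<Rightarrow> bool ampl) \<Rightarrow> (nat \<Rightarrow> 'd ampl) \<Rightarrow> 'd ampl \<Rightarrow> bool ampl" where
  "code_op D \<psi> e = (\<lambda>v w. \<Sum>i=1..D. ketbra (\<psi> i) (e i) v w)"

definition special_block_code ::
  "nat \<Rightarrow> nat \<Rightarrow> nat \<Rightarrow> (nat list \<Rightarrow> 'd::finite ampl \<Rightarrow> bool ampl) \<Rightarrow> bool" where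
  "special_block_code N m l U \<longleftrightarrow>
     (\<forall>h\<in>histories N m l. fock_isometry l (U h)) \<and>
     (\<exists>\<psi> e. (\<forall>i\<in>{1..CARD('d) ^ l}. \<exists>k. length_codeword k (\<psi> i)) \<and>
        jointly_orthonormal (CARD('d) ^ l) \<psi> \<and>
        (\<forall>h\<in>histories N m l. onb l (CARD('d) ^ l) (e h) \<and>
           (\<forall>v\<in>tpow l. U h v = code_op (CARD('d) ^ l) \<psi> (e h) v)))"

definition fock_proj :: "nat \<Rightarrow> bool ampl \<Rightarrow> bool ampl" where
  "fock_proj k x = (\<lambda>w. if length w = k then x w else 0)"

definition length_obs :: "bool ampl \<Rightarrow> bool ampl" where
  "length_obs x = (\<lambda>w. \<Sum>\<^sub>\<infinity>k. of_nat k * fock_proj k x w)"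

definition encoded ::
  "(nat \<Rightarrow> complex ^ 'd) \<Rightarrow> nat \<Rightarrow> nat \<Rightarrow> (nat list \<Rightarrow> 'd ampl \<Rightarrow> bool ampl) \<Rightarrow> nat list \<Rightarrow> bool ampl" where
  "encoded s m l U ns = cats (map
     (\<lambda>k. U (take (k * l) ns) (prod_state s (take l (drop (k * l) ns)))) [0..<m])"

text \<open>The trace is real, as the length observable is self-adjoint.\<close>

definition avg_length ::
  "nat \<Rightarrow> (nat \<Rightarrow> complex ^ 'd) \<Rightarrow> (nat list \<Rightarrow> real) \<Rightarrow> nat \<Rightarrow> nat \<Rightarrow>
   (nat list \<Rightarrow> 'd ampl \<Rightarrow> bool ampl) \<Rightarrow> real" where
  "avg_length N s p m l U = (\<Sum>ns\<in>words N (m * l). p ns *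
     Re (trace_on UNIV (ketbra (encoded s m l U ns) (encoded s m l U ns) \<circ> length_obs)))"

definition ILS ::
  "nat \<Rightarrow> (nat \<Rightarrow> complex ^ 'd) \<Rightarrow> (nat list \<Rightarrow> real) \<Rightarrow> nat \<Rightarrow> nat \<Rightarrow> real" where
  "ILS N s p m l = Inf (avg_length N s p m l ` {U. special_block_code N m l U})"

text \<open>Sequences are indexed by \<open>1, \<dots>, D\<close>; their values at other indices play no role.\<close>

definition kraft_lengths :: "nat \<Rightarrow> (nat \<Rightarrow> nat) set" where
  "kraft_lengths D = {ls. mono_on {1..D} ls \<and> (\<Sum>i=1..D. 1 / 2 ^ ls i) \<le> (1::real)}"

definition length_functional ::
  "nat \<Rightarrow> (nat list \<Rightarrow> real) \<Rightarrow> nat \<Rightarrow> nat \<Rightarrow> nat \<Rightarrow> (nat list \<Rightarrow> nat \<Rightarrow> real) \<Rightarrow> (nat \<Rightarrow> nat) \<Rightarrow> real" where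
  "length_functional N p m l D lam ls =
     (\<Sum>j=2..m. \<Sum>ns\<in>words N ((j - 1) * l). p ns * (\<Sum>i=1..D. lam ns i * real (ls i))) +
     (\<Sum>i=1..D. lam [] i * real (ls i))"

end

theory Submission
  imports Defs "HOL-Library.Sublist"
begin

text \<open>
  Writing the \<open>k\<close>-th encoded block in the codewords \<open>\<psi> i\<close>, with amplitudes \<open>ip (e i) s\<close>, makes the
  encoded string a combination of the orthonormal products \<open>\<psi> v1 \<circ> \<dots> \<circ> \<psi> vm\<close> of definite
  length, so its expected length is a sum over the blocks.  Averaging over the source turns the
  squared amplitudes into the diagonal of the conditional state in the basis \<open>e\<close>, that is, into its
  eigenvalues mixed by a doubly stochastic matrix.  Hence, for given lengths in increasing order,
  eigenbases with decreasing eigenvalues are optimal for all histories at once.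

  The lengths of jointly orthonormal codewords satisfy the Kraft inequality by McMillan's argument:
  at most \<open>2\<^sup>t\<close> of the \<open>n\<close>-fold products have length \<open>t\<close>.  Conversely, Kraft lengths are
  realised by a classical prefix code.
\<close>

section \<open>Rearrangement\<close>

text \<open>
  The diagonal is optimal for the assignment problem with costs \<open>lam j * c i\<close>: the partial sums
  \<open>u\<close> give a dual feasible solution that is tight on the diagonal.
\<close>

lemma doubly_stochastic_rearrangement:
  fixes B :: "nat \<Rightarrow> nat \<Rightarrow> real"
  assumes lam: "antimono_on {1..D} lam" and c: "mono_on {1..D} c"
    and nonneg: "\<And>i j. B i j \<ge> 0"
    and rows: "\<And>i. i \<in> {1..D} \<Longrightarrow> (\<Sum>j=1..D. B i j) = 1"
    and cols: "\<And>j. j \<in> {1..D} \<Longrightarrow> (\<Sum>i=1..D. B i j) = 1"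
  shows "(\<Sum>i=1..D. lam i * c i) \<le> (\<Sum>i=1..D. (\<Sum>j=1..D. B i j * lam j) * c i)"
proof -
  define u where "u i = (\<Sum>t=1..<i. lam (Suc t) * (c (Suc t) - c t))" for i
  have diff: "u j - u i = (\<Sum>t=i..<j. lam (Suc t) * (c (Suc t) - c t))"
    "c j - c i = (\<Sum>t=i..<j. c (Suc t) - c t)" if "1 \<le> i" "i \<le> j" for i j
    using that sum.atLeastLessThan_concat[of 1 i j "\<lambda>t. lam (Suc t) * (c (Suc t) - c t)"]
    by (simp_all add: u_def sum_Suc_diff')
  \<comment> \<open>Dual feasibility: the increments of \<open>u\<close> weigh those of
    \<open>c\<close> by values of \<open>lam\<close>, which are at most \<open>lam j\<close> beyond
    \<open>j\<close> and at least \<open>lam j\<close> up to \<open>j\<close>.\<close>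
  have feas: "u i - u j \<le> lam j * (c i - c j)" if ij: "i \<in> {1..D}" "j \<in> {1..D}" for i j
  proof (cases "j \<le> i")
    case True
    have "u i - u j \<le> (\<Sum>t=j..<i. lam j * (c (Suc t) - c t))"
      using ij True
      by (subst diff(1)) (auto intro!: sum_mono mult_right_mono monotone_onD[OF lam] monotone_onD[OF c])
    also have "\<dots> = lam j * (c i - c j)" using ij True by (subst diff(2)) (auto simp: sum_distrib_left)
    finally show ?thesis .
  next
    case False
    have "lam j * (c j - c i) = (\<Sum>t=i..<j. lam j * (c (Suc t) - c t))"
      using ij False by (subst diff(2)) (auto simp: sum_distrib_left)
    also have "\<dots> \<le> u j - u i"
      using ij False
      by (subst diff(1)) (auto intro!: sum_mono mult_right_mono monotone_onD[OF lam] monotone_onD[OF c])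
    finally show ?thesis by (simp add: algebra_simps)
  qed
  \<comment> \<open>Weak duality: unit row sums carry the prices \<open>u i\<close>, unit column
    sums the prices \<open>lam j * c j - u j\<close>.\<close>
  have "(\<Sum>i=1..D. lam i * c i) = (\<Sum>i=1..D. u i) + (\<Sum>j=1..D. lam j * c j - u j)"
    by (simp add: sum_subtractf)
  also have "\<dots> = (\<Sum>i=1..D. (\<Sum>j=1..D. B i j) * u i) + (\<Sum>j=1..D. (\<Sum>i=1..D. B i j) * (lam j * c j - u j))"
    using rows cols by simp
  also have "\<dots> = (\<Sum>i=1..D. \<Sum>j=1..D. B i j * u i) + (\<Sum>i=1..D. \<Sum>j=1..D. B i j * (lam j * c j - u j))"
    by (simp only: sum_distrib_right) (simp only: sum.swap[of "\<lambda>j i. B i j * (lam j * c j - u j)"])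
  also have "\<dots> = (\<Sum>i=1..D. \<Sum>j=1..D. B i j * (u i + (lam j * c j - u j)))"
    by (simp only: distrib_left sum.distrib)
  also have "\<dots> \<le> (\<Sum>i=1..D. \<Sum>j=1..D. B i j * (lam j * c i))"
  proof (intro sum_mono mult_left_mono nonneg)
    fix i j assume "i \<in> {1..D}" "j \<in> {1..D}"
    from feas[OF this] show "u i + (lam j * c j - u j) \<le> lam j * c i" by (simp add: algebra_simps)
  qed
  also have "\<dots> = (\<Sum>i=1..D. (\<Sum>j=1..D. B i j * lam j) * c i)"
    by (simp add: sum_distrib_right mult.assoc)
  finally show ?thesis .
qed

text \<open>The codewords of a given code come in no particular order, while
  \<open>kraft_lengths\<close> asks for increasing lengths. The shift by one passes from list
  positions, which start at 0, to indices, which start at 1.\<close>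

lemma ex_sorting:
  fixes L :: "nat \<Rightarrow> 'a::linorder"
  shows "\<exists>\<pi>. bij_betw \<pi> {1..D} {1..D} \<and> mono_on {1..D} (\<lambda>i. L (\<pi> i))"
proof -
  define xs where "xs = sort_key L [1..<Suc D]"
  have len: "length xs = D" and set: "set xs = {1..D}" and "distinct xs"
    by (auto simp: xs_def)
  then have "bij_betw ((!) xs) {..<D} {1..D}" by (intro bij_betw_nth) auto
  moreover have "bij_betw (\<lambda>i. i - 1) {1..D} {..<D}"
    by (rule bij_betw_byWitness[of _ Suc]) auto
  ultimately have "bij_betw ((!) xs \<circ> (\<lambda>i. i - 1)) {1..D} {1..D}" by (rule bij_betw_trans[rotated])
  moreover have "sorted (map L xs)" by (simp add: xs_def)
  then have "L (xs ! (i - 1)) \<le> L (xs ! (j - 1))" if "i \<in> {1..D}" "j \<in> {1..D}" "i \<le> j" for i j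
    using sorted_nth_mono[of "map L xs" "i - 1" "j - 1"] that len by auto
  then have "mono_on {1..D} (\<lambda>i. L (((!) xs \<circ> (\<lambda>i. i - 1)) i))" by (auto intro!: mono_onI)
  ultimately show ?thesis by blast
qed

section \<open>Finitely supported vectors\<close>

text \<open>Vectors in a tensor power over a finite alphabet have finite support, and on these the
  infinite sum in \<open>ip\<close> becomes a finite one.\<close>

definition supp :: "'a ampl \<Rightarrow> 'a list set" where
  "supp x = {w. x w \<noteq> 0}"

lemma finite_words_length: "finite {w :: 'a::finite list. length w = k}"
  using finite_lists_length_eq[of "UNIV :: 'a set" k] by simp

lemma card_words_length: "card {w :: 'a::finite list. length w = k} = CARD('a) ^ k"
  using card_lists_length_eq[of "UNIV :: 'a set" k] by simp

lemma finite_supp_tpow: "x \<in> tpow k \<Longrightarrow> finite (supp (x :: 'a::finite ampl))"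
  by (rule finite_subset[OF _ finite_words_length[of k]]) (auto simp: supp_def tpow_def)

lemma finite_supp_sum:
  assumes "finite I" "\<And>i. i \<in> I \<Longrightarrow> finite (supp (x i))"
  shows "finite (supp (\<lambda>w. \<Sum>i\<in>I. c i * x i w))"
proof (rule finite_subset)
  show "supp (\<lambda>w. \<Sum>i\<in>I. c i * x i w) \<subseteq> (\<Union>i\<in>I. supp (x i))"
  proof
    fix w assume "w \<in> supp (\<lambda>w. \<Sum>i\<in>I. c i * x i w)"
    then obtain i where "i \<in> I" "c i * x i w \<noteq> 0"
      unfolding supp_def using sum.not_neutral_contains_not_neutral by blast
    then show "w \<in> (\<Union>i\<in>I. supp (x i))" by (auto simp: supp_def)
  qed
qed (use assms in auto)

lemma finite_supp_fock:
  assumes "finite (supp x)" shows "x \<in> fock"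
proof -
  have "(\<lambda>w. (cmod (x w))\<^sup>2) summable_on UNIV \<longleftrightarrow> (\<lambda>w. (cmod (x w))\<^sup>2) summable_on supp x"
    by (rule summable_on_cong_neutral) (auto simp: supp_def)
  then show ?thesis using assms by (simp add: fock_def)
qed

lemma ip_finite:
  assumes "finite A" "\<And>w. w \<notin> A \<Longrightarrow> x w = 0 \<or> y w = 0"
  shows "ip x y = (\<Sum>w\<in>A. cnj (x w) * y w)"
proof -
  have "ip x y = (\<Sum>\<^sub>\<infinity>w\<in>A. cnj (x w) * y w)"
    unfolding ip_def by (rule infsum_cong_neutral) (use assms(2) in fastforce)+
  then show ?thesis using assms(1) by simp
qed

lemma ip_ket: "ip (ket u) x = x u"
  by (subst ip_finite[of "{u}"]) (auto simp: ket_def)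

lemma ip_ket_right: "ip x (ket u) = cnj (x u)"
  by (subst ip_finite[of "{u}"]) (auto simp: ket_def)

text \<open>A family that is not summable has the default sum 0, so linearity rests on the finite
  supports; their union is a common range of summation.\<close>

lemma ip_sum_right:
  assumes "finite I" "\<And>i. i \<in> I \<Longrightarrow> finite (supp (y i))"
  shows "ip x (\<lambda>w. \<Sum>i\<in>I. c i * y i w) = (\<Sum>i\<in>I. c i * ip x (y i))"
proof -
  let ?A = "\<Union>i\<in>I. supp (y i)"
  have A: "finite ?A" using assms by auto
  have "ip x (\<lambda>w. \<Sum>i\<in>I. c i * y i w) = (\<Sum>w\<in>?A. cnj (x w) * (\<Sum>i\<in>I. c i * y i w))"
    by (rule ip_finite[OF A]) (auto simp: supp_def)
  also have "\<dots> = (\<Sum>i\<in>I. c i * (\<Sum>w\<in>?A. cnj (x w) * y i w))"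
    by (simp add: sum_distrib_left sum.swap[of _ I] mult_ac)
  also have "\<dots> = (\<Sum>i\<in>I. c i * ip x (y i))"
  proof (rule sum.cong[OF refl])
    fix i assume "i \<in> I"
    then have "ip x (y i) = (\<Sum>w\<in>?A. cnj (x w) * y i w)"
      by (intro ip_finite[OF A]) (auto simp: supp_def)
    then show "c i * (\<Sum>w\<in>?A. cnj (x w) * y i w) = c i * ip x (y i)" by simp
  qed
  finally show ?thesis .
qed

lemma ip_cnj: "cnj (ip x y) = ip y x"
  by (simp add: ip_def flip: infsum_cnj) (simp add: mult.commute)

lemma ip_sum_left:
  assumes "finite I" "\<And>i. i \<in> I \<Longrightarrow> finite (supp (y i))"
  shows "ip (\<lambda>w. \<Sum>i\<in>I. c i * y i w) x = (\<Sum>i\<in>I. cnj (c i) * ip (y i) x)"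
  by (subst ip_cnj[symmetric]) (simp add: ip_sum_right[OF assms] ip_cnj)

lemma ip_sum_orthonormal:
  assumes "finite I" "\<And>i. i \<in> I \<Longrightarrow> finite (supp (y i))" "orthonormal_on I y"
  shows "ip (\<lambda>w. \<Sum>i\<in>I. a i * y i w) (\<lambda>w. \<Sum>i\<in>I. b i * y i w) = (\<Sum>i\<in>I. cnj (a i) * b i)"
proof -
  have "(\<Sum>j\<in>I. b j * ip (y i) (y j)) = b i" if "i \<in> I" for i
  proof -
    have "(\<Sum>j\<in>I. b j * ip (y i) (y j)) = (\<Sum>j\<in>I. if i = j then b j else 0)"
      by (rule sum.cong) (use assms(3) that in \<open>auto simp: orthonormal_on_def\<close>)
    then show ?thesis using assms(1) that by simp
  qed
  then show ?thesis by (simp add: ip_sum_left[OF assms(1,2)] ip_sum_right[OF assms(1,2)])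
qed

lemma cnj_mult_self: "cnj z * z = complex_of_real ((cmod z)\<^sup>2)"
  by (metis complex_norm_square mult.commute)

lemma onb_expand:
  fixes e :: "nat \<Rightarrow> 'a::finite ampl"
  assumes "onb l D e" "x \<in> tpow l"
  shows "x = (\<lambda>w. \<Sum>i=1..D. ip (e i) x * e i w)"
proof -
  obtain c where c: "x = (\<lambda>w. \<Sum>i=1..D. c i * e i w)"
    using assms unfolding onb_def by blast
  have fin: "finite (supp (e i))" if "i \<in> {1..D}" for i
    using assms(1) that finite_supp_tpow unfolding onb_def by blast
  have "ip (e i) x = c i" if i: "i \<in> {1..D}" for i
  proof -
    have "ip (e i) x = (\<Sum>j=1..D. c j * ip (e i) (e j))"
      unfolding c by (rule ip_sum_right) (use fin in auto)
    also have "\<dots> = (\<Sum>j=1..D. if i = j then c j else 0)"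
      by (rule sum.cong) (use assms(1) i in \<open>auto simp: onb_def orthonormal_on_def\<close>)
    finally show ?thesis using i by simp
  qed
  then have "(\<lambda>w. \<Sum>i=1..D. ip (e i) x * e i w) = (\<lambda>w. \<Sum>i=1..D. c i * e i w)"
    by (intro ext sum.cong) auto
  then show ?thesis using c by simp
qed

lemma onb_parseval:
  fixes e :: "nat \<Rightarrow> 'a::finite ampl"
  assumes "onb l D e" "x \<in> tpow l" "y \<in> tpow l"
  shows "ip x y = (\<Sum>i=1..D. cnj (ip (e i) x) * ip (e i) y)"
proof -
  have "ip x y = ip (\<lambda>w. \<Sum>i=1..D. ip (e i) x * e i w) (\<lambda>w. \<Sum>i=1..D. ip (e i) y * e i w)"
    using onb_expand[OF assms(1,2)] onb_expand[OF assms(1,3)] by simp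
  also have "\<dots> = (\<Sum>i=1..D. cnj (ip (e i) x) * ip (e i) y)"
    by (rule ip_sum_orthonormal) (use assms(1) in \<open>auto simp: onb_def intro: finite_supp_tpow\<close>)
  finally show ?thesis .
qed

text \<open>This makes the squared amplitudes of a unit vector a probability distribution, and the
  squared overlaps of two orthonormal bases a doubly stochastic matrix.\<close>

lemma onb_norm:
  fixes e :: "nat \<Rightarrow> 'a::finite ampl"
  assumes "onb l D e" "x \<in> tpow l" "ip x x = 1"
  shows "(\<Sum>i=1..D. (cmod (ip (e i) x))\<^sup>2) = 1"
proof -
  have "complex_of_real (\<Sum>i=1..D. (cmod (ip (e i) x))\<^sup>2) = 1"
    using onb_parseval[OF assms(1,2,2)] assms(3) by (simp add: cnj_mult_self)
  then show ?thesis using of_real_eq_1_iff by blast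
qed

text \<open>
  Bessel's inequality for the basis vector \<open>ket w\<close>: with \<open>b = \<Sum>v. \<bar>\<phi> v w\<bar>\<^sup>2\<close>, the projection \<open>z\<close> of
  \<open>ket w\<close> to the span has \<open>z w = b\<close> and squared norm \<open>b\<close>, hence \<open>b\<^sup>2 \<le> b\<close>.
\<close>

lemma card_orthonormal_le:
  fixes \<phi> :: "'i \<Rightarrow> 'a::finite ampl"
  assumes "finite I" "\<And>i. i \<in> I \<Longrightarrow> \<phi> i \<in> tpow k" "orthonormal_on I \<phi>"
  shows "card I \<le> CARD('a) ^ k"
proof -
  let ?W = "{w :: 'a list. length w = k}"
  have W: "finite ?W" by (rule finite_words_length)
  have bessel: "(\<Sum>i\<in>I. (cmod (\<phi> i w))\<^sup>2) \<le> 1" if w: "w \<in> ?W" for w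
  proof -
    define b where "b = (\<Sum>i\<in>I. (cmod (\<phi> i w))\<^sup>2)"
    define z where "z = (\<lambda>u. \<Sum>i\<in>I. cnj (\<phi> i w) * \<phi> i u)"
    have z0: "z u = 0" if "u \<notin> ?W" for u
      using that assms(2) by (auto simp: z_def tpow_def intro!: sum.neutral)
    have zw: "z w = of_real b" by (simp add: z_def b_def cnj_mult_self)
    have "ip z z = (\<Sum>i\<in>I. cnj (cnj (\<phi> i w)) * cnj (\<phi> i w))"
      unfolding z_def by (rule ip_sum_orthonormal) (use assms finite_supp_tpow in blast)+
    then have "ip z z = of_real b"
      by (simp add: b_def complex_norm_square del: of_real_power)
    moreover have "ip z z = of_real (\<Sum>u\<in>?W. (cmod (z u))\<^sup>2)"
      by (subst ip_finite[OF W]) (use z0 in \<open>auto simp: cnj_mult_self\<close>)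
    ultimately have "b = (\<Sum>u\<in>?W. (cmod (z u))\<^sup>2)" using of_real_eq_iff by metis
    moreover have "(cmod (z w))\<^sup>2 \<le> (\<Sum>u\<in>?W. (cmod (z u))\<^sup>2)"
      by (rule member_le_sum[OF w]) (use W in auto)
    ultimately have "b * b \<le> b" by (simp only: zw norm_of_real power2_abs power2_eq_square[symmetric])
    moreover have "0 \<le> b" by (auto simp: b_def intro: sum_nonneg)
    ultimately have "b \<le> 1" using mult_le_cancel_left1[of b b] by (cases "b = 0") auto
    then show ?thesis by (simp add: b_def)
  qed
  have "(\<Sum>w\<in>?W. (cmod (\<phi> i w))\<^sup>2) = 1" if i: "i \<in> I" for i
  proof -
    have "ip (\<phi> i) (\<phi> i) = of_real (\<Sum>w\<in>?W. (cmod (\<phi> i w))\<^sup>2)"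
      by (subst ip_finite[OF W]) (use assms(2)[OF i] in \<open>auto simp: cnj_mult_self tpow_def\<close>)
    moreover have "ip (\<phi> i) (\<phi> i) = 1" using assms(3) i by (simp add: orthonormal_on_def)
    ultimately show ?thesis using of_real_eq_1_iff by metis
  qed
  \<comment> \<open>Double counting of the total squared amplitude: each vector contributes 1, each
    word at most 1.\<close>
  then have "real (card I) = (\<Sum>i\<in>I. \<Sum>w\<in>?W. (cmod (\<phi> i w))\<^sup>2)" by simp
  also have "\<dots> = (\<Sum>w\<in>?W. \<Sum>i\<in>I. (cmod (\<phi> i w))\<^sup>2)" by (rule sum.swap)
  also have "\<dots> \<le> (\<Sum>w\<in>?W. 1)" by (rule sum_mono) (rule bessel)
  finally have "real (card I) \<le> real (CARD('a) ^ k)" by (simp add: card_words_length)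
  then show ?thesis by (simp only: of_nat_le_iff)
qed

section \<open>Index strings\<close>

lemma words_0: "words N 0 = {[]}"
  by (auto simp: words_def)

lemma words_1: "words N 1 = (\<lambda>i. [i]) ` {1..N}"
  by (auto simp: words_def length_Suc_conv)

lemma finite_words: "finite (words N q)"
  unfolding words_def using finite_lists_length_eq[of "{1..N}" q] by (simp add: conj_commute)

lemma sum_words_add:
  "(\<Sum>ns\<in>words N (a + b). f ns) = (\<Sum>u\<in>words N a. \<Sum>v\<in>words N b. f (u @ v))"
proof -
  have "(\<Sum>u\<in>words N a. \<Sum>v\<in>words N b. f (u @ v)) =
      (\<Sum>(u, v)\<in>words N a \<times> words N b. f (u @ v))"
    by (simp add: sum.cartesian_product)
  also have "\<dots> = (\<Sum>ns\<in>words N (a + b). f ns)"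
    by (rule sum.reindex_bij_witness[of _ "\<lambda>ns. (take a ns, drop a ns)" "\<lambda>(u, v). u @ v"])
      (auto simp: words_def dest: in_set_takeD in_set_dropD)
  finally show ?thesis by simp
qed

lemma sum_words_Suc:
  "(\<Sum>v\<in>words D (Suc n). f v) = (\<Sum>i=1..D. \<Sum>v\<in>words D n. f (i # v))"
  using sum_words_add[of f D 1 n] unfolding words_1 plus_1_eq_Suc by (simp add: sum.reindex inj_on_def)

text \<open>The distributive law; it turns powers of the Kraft sum into sums over index
  strings.\<close>

lemma sum_words_prod:
  fixes g :: "nat \<Rightarrow> nat \<Rightarrow> 'b::comm_semiring_1"
  shows "(\<Sum>v\<in>words D n. \<Prod>k<n. g k (v ! k)) = (\<Prod>k<n. \<Sum>i=1..D. g k i)"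
proof (induction n arbitrary: g)
  case (Suc n)
  have "(\<Sum>v\<in>words D (Suc n). \<Prod>k<Suc n. g k (v ! k)) =
      (\<Sum>i=1..D. g 0 i * (\<Sum>v\<in>words D n. \<Prod>k<n. g (Suc k) (v ! k)))"
    by (simp add: sum_words_Suc prod.lessThan_Suc_shift sum_distrib_left del: prod.lessThan_Suc)
  then show ?case
    by (simp add: Suc.IH[of "\<lambda>k. g (Suc k)"] prod.lessThan_Suc_shift sum_distrib_right
        del: prod.lessThan_Suc)
qed (simp add: words_0)

text \<open>Linearity of expectation: the length of one coordinate is weighted by \<open>g k\<close>
  alone, because the weights of all other coordinates sum to 1.\<close>

lemma sum_words_prod_sum_list:
  fixes g :: "nat \<Rightarrow> nat \<Rightarrow> real"
  assumes "\<And>k. k < n \<Longrightarrow> (\<Sum>i=1..D. g k i) = 1"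
  shows "(\<Sum>v\<in>words D n. (\<Prod>k<n. g k (v ! k)) * real (sum_list (map L v))) =
    (\<Sum>k<n. \<Sum>i=1..D. g k i * real (L i))"
  using assms
proof (induction n arbitrary: g)
  case (Suc n)
  let ?P = "\<lambda>v. \<Prod>k<n. g (Suc k) (v ! k)"
  have 1: "(\<Sum>v\<in>words D n. ?P v) = 1"
    using sum_words_prod[where n = n and D = D and g = "\<lambda>k. g (Suc k)"] Suc.prems by simp
  have IH: "(\<Sum>v\<in>words D n. ?P v * real (sum_list (map L v))) =
      (\<Sum>k<n. \<Sum>i=1..D. g (Suc k) i * real (L i))"
    using Suc.IH[of "\<lambda>k. g (Suc k)"] Suc.prems by simp
  have "(\<Sum>v\<in>words D (Suc n). (\<Prod>k<Suc n. g k (v ! k)) * real (sum_list (map L v))) =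
      (\<Sum>i=1..D. \<Sum>v\<in>words D n. g 0 i * real (L i) * ?P v +
         g 0 i * (?P v * real (sum_list (map L v))))"
    by (simp add: sum_words_Suc prod.lessThan_Suc_shift algebra_simps del: prod.lessThan_Suc)
  also have "\<dots> = (\<Sum>i=1..D. g 0 i * real (L i) * (\<Sum>v\<in>words D n. ?P v) +
         g 0 i * (\<Sum>v\<in>words D n. ?P v * real (sum_list (map L v))))"
    by (simp only: sum.distrib sum_distrib_left)
  also have "\<dots> = (\<Sum>i=1..D. g 0 i * real (L i)) +
      (\<Sum>i=1..D. g 0 i) * (\<Sum>k<n. \<Sum>i=1..D. g (Suc k) i * real (L i))"
    by (simp add: 1 IH sum.distrib sum_distrib_right)
  finally show ?case
    using Suc.prems[of 0] by (simp add: sum.lessThan_Suc_shift del: sum.lessThan_Suc)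
qed (simp add: words_0)

section \<open>Concatenation of qubit strings\<close>

lemma finite_splits: "finite {(u, v). u @ v = (w :: 'a list)}"
proof (rule finite_subset)
  show "{(u, v). u @ v = w} \<subseteq> (\<lambda>i. (take i w, drop i w)) ` {..length w}"
  proof clarify
    fix a b :: "'a list"
    show "(a, b) \<in> (\<lambda>i. (take i (a @ b), drop i (a @ b))) ` {..length (a @ b)}"
      by (rule image_eqI[of _ _ "length a"]) auto
  qed
qed simp

text \<open>An amplitude of a concatenation is a sum over the splittings of one word, so bilinearity
  is an exchange of sums.\<close>

lemma cat_sum:
  "cat (\<lambda>w. \<Sum>i\<in>I. a i * x i w) (\<lambda>w. \<Sum>j\<in>J. b j * y j w) =
    (\<lambda>w. \<Sum>i\<in>I. \<Sum>j\<in>J. a i * b j * cat (x i) (y j) w)"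
proof
  fix w :: "bool list"
  let ?S = "{(u, v). u @ v = w}"
  have "cat (\<lambda>w. \<Sum>i\<in>I. a i * x i w) (\<lambda>w. \<Sum>j\<in>J. b j * y j w) w =
      (\<Sum>q\<in>?S. \<Sum>i\<in>I. \<Sum>j\<in>J. a i * b j * (x i (fst q) * y j (snd q)))"
    unfolding cat_def by (simp add: case_prod_beta sum_product mult_ac)
  also have "\<dots> = (\<Sum>i\<in>I. \<Sum>j\<in>J. \<Sum>q\<in>?S. a i * b j * (x i (fst q) * y j (snd q)))"
    by (simp only: sum.swap[of _ _ ?S])
  finally show "cat (\<lambda>w. \<Sum>i\<in>I. a i * x i w) (\<lambda>w. \<Sum>j\<in>J. b j * y j w) w =
      (\<Sum>i\<in>I. \<Sum>j\<in>J. a i * b j * cat (x i) (y j) w)"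
    by (simp add: cat_def case_prod_beta sum_distrib_left)
qed

lemma cats_Cons: "cats (x # xs) = cat x (cats xs)"
  by (simp add: cats_def)

text \<open>Multilinear expansion of a concatenation. An arbitrary list \<open>ks\<close> in place
  of \<open>[0..<m]\<close> lets the induction remove the first entry.\<close>

lemma cats_sum:
  "cats (map (\<lambda>k w. \<Sum>i=1..D. c k i * \<psi> i w) ks) =
    (\<lambda>w. \<Sum>v\<in>words D (length ks). (\<Prod>k<length ks. c (ks ! k) (v ! k)) * cats (map \<psi> v) w)"
proof (induction ks)
  case Nil
  then show ?case by (simp add: cats_def words_0)
next
  case (Cons k ks)
  then show ?case
    by (simp add: cats_Cons cat_sum sum_words_Suc prod.lessThan_Suc_shift del: prod.lessThan_Suc)
qed

lemma cats_ket: "cats (map (\<lambda>i. ket (\<omega> i)) v) = ket (concat (map \<omega> v))"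
  by (induction v) (simp_all add: cats_Cons cat_ket, simp add: cats_def)

lemma ket_tpow: "ket u \<in> tpow (length u)"
  by (auto simp: ket_def tpow_def)

lemma cat_tpow:
  assumes "x \<in> tpow j" "y \<in> tpow k" shows "cat x y \<in> tpow (j + k)"
  using assms unfolding tpow_def cat_def by (fastforce intro!: sum.neutral)

lemma cats_tpow:
  assumes "\<And>i. i \<in> set v \<Longrightarrow> \<psi> i \<in> tpow (L i)"
  shows "cats (map \<psi> v) \<in> tpow (sum_list (map L v))"
  using assms
proof (induction v)
  case Nil
  then show ?case using ket_tpow[of "[]"] by (simp add: cats_def)
next
  case (Cons a v)
  then show ?case by (simp add: cats_Cons cat_tpow)
qed

text \<open>The case \<open>M = 1\<close>. As \<open>cats\<close> ends its fold with
  \<open>ket []\<close>, this requires the empty string to be a right unit of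
  \<open>cat\<close>.\<close>

lemma jointly_orthonormal_1:
  assumes "jointly_orthonormal D \<psi>" shows "orthonormal_on {1..D} \<psi>"
proof -
  have "cat x (ket []) = x" for x :: "bool ampl"
  proof
    fix w
    have "cat x (ket []) w = (\<Sum>q\<in>{(u, v). u @ v = w}. if q = (w, []) then x w else 0)"
      unfolding cat_def ket_def by (rule sum.cong) (auto split: if_splits)
    then show "cat x (ket []) w = x w" by (simp add: finite_splits)
  qed
  then have "cats [x] = x" for x by (simp add: cats_def)
  moreover have "orthonormal_on (words D 1) (\<lambda>v. cats (map \<psi> v))"
    using assms unfolding jointly_orthonormal_def by blast
  ultimately show ?thesis by (simp add: orthonormal_on_def words_1 del: One_nat_def)
qed

text \<open>Products of qubit strings are standard basis vectors, orthogonal as soon as the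
  concatenated bit strings differ. Only index strings of equal length are compared; for
  \<open>D = 1\<close> there is just one of each length, so even the empty codeword is
  covered.\<close>

lemma jointly_orthonormal_ket:
  assumes "D = 1 \<or> uniquely_decodable D \<omega>"
  shows "jointly_orthonormal D (\<lambda>i. ket (\<omega> i))"
proof -
  have "u = v" if "concat (map \<omega> u) = concat (map \<omega> v)" "u \<in> words D n" "v \<in> words D n" for u v n
    using assms
  proof
    assume "D = 1"
    then have "u = replicate n 1" "v = replicate n 1"
      using that(2,3) by (auto simp: words_def intro!: replicate_eqI)
    then show ?thesis by simp
  next
    assume "uniquely_decodable D \<omega>"
    then show ?thesis
      using that by (auto simp: uniquely_decodable_def words_def lists_eq_set inj_on_def)
  qed
  moreover have "ip (ket u) (ket v) = (if u = v then 1 else 0)" for u v :: "bool list"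
    unfolding ip_ket by (simp add: ket_def)
  moreover have "ket (\<omega> i) \<in> fock" for i
    by (rule finite_supp_fock[OF finite_supp_tpow[OF ket_tpow]])
  ultimately show ?thesis
    unfolding jointly_orthonormal_def orthonormal_on_def cats_ket by (auto; metis)
qed

section \<open>The Kraft-McMillan inequality\<close>

text \<open>Expand \<open>K ^ n\<close> over the \<open>n\<close>-fold products and group them by
  total length \<open>t\<close>: each group contributes at most 1, and there are at most
  \<open>n * B + 1\<close> groups. A linear bound on all powers is incompatible with
  \<open>K > 1\<close>.\<close>

theorem kraft_mcmillan_quantum:
  assumes cw: "\<And>i. i \<in> {1..D} \<Longrightarrow> length_codeword (L i) (\<psi> i)"
    and jo: "jointly_orthonormal D \<psi>"
  shows "(\<Sum>i=1..D. 1 / 2 ^ L i) \<le> (1::real)"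
proof (rule ccontr)
  define K :: real where "K = (\<Sum>i=1..D. 1 / 2 ^ L i)"
  \<comment> \<open>Any common upper bound of the lengths would serve; the sum also makes sense for
    an empty range.\<close>
  define B where "B = (\<Sum>i=1..D. L i)"
  assume "\<not> ?thesis"
  then have K: "K > 1" by (simp add: K_def)
  have bound: "K ^ n \<le> real n * (B + 1)" if n: "n \<ge> 1" for n
  proof -
    let ?T = "\<lambda>v. sum_list (map L v)"
    have T: "(\<Prod>k<n. 1 / 2 ^ L (v ! k)) = (1 / 2 ^ ?T v :: real)" if "v \<in> words D n" for v
    proof -
      have "?T v = (\<Sum>k<n. L (v ! k))"
        using that by (simp add: words_def sum_list_sum_nth atLeast0LessThan)
      then show ?thesis by (simp add: prod_dividef power_sum)
    qed
    have TB: "?T v \<le> n * B" if "v \<in> words D n" for v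
    proof -
      have "L i \<le> B" if "i \<in> {1..D}" for i
        unfolding B_def by (rule member_le_sum[OF that]) auto
      then have "?T v \<le> sum_list (map (\<lambda>_. B) v)"
        using that by (intro sum_list_mono) (auto simp: words_def)
      then show ?thesis using that by (simp add: words_def sum_list_triv)
    qed
    have "K ^ n = (\<Prod>k<n. \<Sum>i=1..D. 1 / 2 ^ L i)" by (simp add: K_def)
    also have "\<dots> = (\<Sum>v\<in>words D n. \<Prod>k<n. 1 / 2 ^ L (v ! k))"
      by (rule sum_words_prod[symmetric])
    also have "\<dots> = (\<Sum>v\<in>words D n. 1 / 2 ^ ?T v)" by (rule sum.cong) (auto simp: T)
    also have "\<dots> = (\<Sum>t\<in>{..n * B}. \<Sum>v\<in>{v \<in> words D n. ?T v = t}. 1 / 2 ^ ?T v)"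
      by (rule sum.group[symmetric]) (use TB finite_words in auto)
    also have "\<dots> \<le> (\<Sum>t\<in>{..n * B}. 1)"
    proof (rule sum_mono)
      fix t
      let ?I = "{v \<in> words D n. ?T v = t}"
      have "card ?I \<le> CARD(bool) ^ t"
      proof (rule card_orthonormal_le)
        show "finite ?I" using finite_words[of D n] by simp
        show "cats (map \<psi> v) \<in> tpow t" if "v \<in> ?I" for v
        proof -
          have "\<psi> i \<in> tpow (L i)" if "i \<in> set v" for i
            using cw[of i] that \<open>v \<in> ?I\<close> by (auto simp: words_def length_codeword_def)
          then show ?thesis using cats_tpow[of v \<psi> L] that by simp
        qed
        show "orthonormal_on ?I (\<lambda>v. cats (map \<psi> v))"
          using jo n by (auto simp: jointly_orthonormal_def orthonormal_on_def)
      qed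
      then have "real (card ?I) \<le> real (2 ^ t)" by (intro of_nat_mono) simp
      then have "real (card ?I) \<le> 2 ^ t" by simp
      moreover have "(\<Sum>v\<in>?I. 1 / 2 ^ ?T v) = real (card ?I) / 2 ^ t" by simp
      ultimately show "(\<Sum>v\<in>?I. 1 / 2 ^ ?T v) \<le> (1::real)" by simp
    qed
    also have "\<dots> = real (n * B + 1)" by simp
    also have "\<dots> \<le> real (n * (B + 1))" using n by (intro of_nat_mono) simp
    finally show ?thesis by (simp add: algebra_simps)
  qed
  have "(\<lambda>n. real n / K ^ n) \<longlonglongrightarrow> 0" using lim_n_over_pown[of K] K by simp
  then have "\<forall>\<^sub>F n in sequentially. real n / K ^ n < 1 / (B + 1)"
    by (rule order_tendstoD) simp
  then obtain n0 where n0: "real n / K ^ n < 1 / (B + 1)" if "n \<ge> n0" for n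
    by (auto simp: eventually_sequentially)
  \<comment> \<open>\<open>Suc n0\<close> rather than \<open>n0\<close>, because the bound on
    \<open>K ^ n\<close> asks for \<open>n \<ge> 1\<close>.\<close>
  have "real (Suc n0) / K ^ Suc n0 < 1 / (B + 1)" by (rule n0) simp
  then have "real (Suc n0) * (B + 1) < K ^ Suc n0" using K by (simp add: field_simps)
  then show False using bound[of "Suc n0"] by simp
qed

text \<open>
  Sorted lengths let the codewords be chosen greedily: at most \<open>2\<^sup>n \<Sum>j<i. 2\<^sup>-\<^sup>L\<^sup>j\<close> words of length
  \<open>n = L i\<close> extend an earlier codeword.
\<close>

lemma kraft_prefix_code:
  assumes "ls \<in> kraft_lengths D"
  shows "\<exists>\<omega> :: nat \<Rightarrow> bool list. (\<forall>i\<in>{1..D}. length (\<omega> i) = ls i) \<and>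
    (\<forall>i\<in>{1..D}. \<forall>j\<in>{1..D}. i \<noteq> j \<longrightarrow> \<not> prefix (\<omega> i) (\<omega> j))"
proof -
  \<comment> \<open>The greedy choice only prevents earlier codewords from being prefixes of later
    ones; the other direction follows from the order of the lengths.\<close>
  have "n \<le> D \<Longrightarrow> \<exists>\<omega> :: nat \<Rightarrow> bool list. (\<forall>i\<in>{1..n}. length (\<omega> i) = ls i) \<and>
    (\<forall>i\<in>{1..n}. \<forall>j\<in>{1..n}. i < j \<longrightarrow> \<not> prefix (\<omega> i) (\<omega> j))" for n
  proof (induction n)
    case (Suc n)
    then obtain \<omega> :: "nat \<Rightarrow> bool list" where
      len: "\<And>i. i \<in> {1..n} \<Longrightarrow> length (\<omega> i) = ls i" and
      pre: "\<And>i j. i \<in> {1..n} \<Longrightarrow> j \<in> {1..n} \<Longrightarrow> i < j \<Longrightarrow> \<not> prefix (\<omega> i) (\<omega> j)"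
      by (metis Suc_leD)
    define k where "k = ls (Suc n)"
    have le: "ls i \<le> k" if "i \<in> {1..n}" for i
      using assms Suc.prems that by (auto simp: kraft_lengths_def k_def intro: mono_onD)
    let ?E = "\<lambda>i. (\<lambda>u. \<omega> i @ u) ` {u :: bool list. length u = k - ls i}"
    have "real (card (\<Union>i\<in>{1..n}. ?E i)) \<le> real (\<Sum>i=1..n. card (?E i))"
      by (intro of_nat_mono card_UN_le) simp
    also have "\<dots> = (\<Sum>i=1..n. 2 ^ (k - ls i))"
      by (simp add: card_image inj_on_def card_words_length)
    also have "\<dots> = 2 ^ k * (\<Sum>i=1..n. 1 / 2 ^ ls i)"
      unfolding sum_distrib_left by (rule sum.cong) (use le in \<open>auto simp: power_diff\<close>)
    \<comment> \<open>The share \<open>1 / 2 ^ k\<close> of the new codeword makes the estimate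
      strict, so some word of length \<open>k\<close> is still free.\<close>
    also have "\<dots> < 2 ^ k * ((\<Sum>i=1..n. 1 / 2 ^ ls i) + 1 / 2 ^ k)" by (simp add: algebra_simps)
    also have "\<dots> = 2 ^ k * (\<Sum>i=1..Suc n. 1 / 2 ^ ls i)" by (simp add: k_def)
    also have "\<dots> \<le> 2 ^ k * (\<Sum>i=1..D. 1 / 2 ^ ls i)"
      using Suc.prems by (intro mult_left_mono sum_mono2) auto
    also have "\<dots> \<le> 2 ^ k * 1"
      using assms by (intro mult_left_mono) (auto simp: kraft_lengths_def)
    finally have "card (\<Union>i\<in>{1..n}. ?E i) < 2 ^ k" by (simp flip: of_nat_less_iff)
    then have less: "card (\<Union>i\<in>{1..n}. ?E i) < card {u :: bool list. length u = k}"
      by (simp add: card_words_length)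
    have "\<not> {u :: bool list. length u = k} \<subseteq> (\<Union>i\<in>{1..n}. ?E i)"
    proof
      assume sub: "{u :: bool list. length u = k} \<subseteq> (\<Union>i\<in>{1..n}. ?E i)"
      have "finite (\<Union>i\<in>{1..n}. ?E i)" by (simp add: finite_words_length)
      from card_mono[OF this sub] show False using less by linarith
    qed
    then obtain u where u: "length u = k" "u \<notin> (\<Union>i\<in>{1..n}. ?E i)" by blast
    have nu: "\<not> prefix (\<omega> i) u" if "i \<in> {1..n}" for i
    proof
      assume "prefix (\<omega> i) u"
      then have "u \<in> ?E i" using u(1) len[OF that] by (auto simp: prefix_def)
      then show False using u(2) that by blast
    qed
    show ?case
      by (rule exI[of _ "fun_upd \<omega> (Suc n) u"])
        (use len pre nu u(1) in \<open>auto simp: k_def le_Suc_eq\<close>)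
  qed simp
  then obtain \<omega> :: "nat \<Rightarrow> bool list" where
    len: "\<And>i. i \<in> {1..D} \<Longrightarrow> length (\<omega> i) = ls i" and
    pre: "\<And>i j. i \<in> {1..D} \<Longrightarrow> j \<in> {1..D} \<Longrightarrow> i < j \<Longrightarrow> \<not> prefix (\<omega> i) (\<omega> j)"
    by (metis order_refl)
  have "\<not> prefix (\<omega> i) (\<omega> j)" if ij: "i \<in> {1..D}" "j \<in> {1..D}" "i \<noteq> j" for i j
  proof (cases "i < j")
    case False
    \<comment> \<open>A prefix that is at least as long as the whole word equals it, which reduces
      the case \<open>j < i\<close> to the order already treated.\<close>
    then have "ls j \<le> ls i" using assms ij by (auto simp: kraft_lengths_def intro: mono_onD)
    then have "prefix (\<omega> i) (\<omega> j) \<Longrightarrow> prefix (\<omega> j) (\<omega> i)"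
      using len[OF ij(1)] len[OF ij(2)] by (auto simp: prefix_def) (simp flip: length_0_conv)
    then show ?thesis using pre[of j i] ij False by auto
  qed (use pre ij in blast)
  then show ?thesis using len by blast
qed

text \<open>Decode from the left: the first codewords of two equal concatenations are comparable,
  hence equal, and cancel. With two or more codewords none is empty, since the empty word is a
  prefix of all others.\<close>

lemma prefix_free_uniquely_decodable:
  assumes pf: "\<And>i j. i \<in> {1..D} \<Longrightarrow> j \<in> {1..D} \<Longrightarrow> i \<noteq> j \<Longrightarrow> \<not> prefix (\<omega> i) (\<omega> j)"
    and D: "D \<ge> 2"
  shows "uniquely_decodable D \<omega>"
proof -
  have ne: "\<omega> i \<noteq> []" if i: "i \<in> {1..D}" for i
  proof -
    have "\<exists>j\<in>{1..D}. i \<noteq> j" 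
    proof (cases "i = 1")
      case True
      then show ?thesis using D by (intro bexI[of _ 2]) auto
    next
      case False
      then show ?thesis using D by (intro bexI[of _ 1]) auto
    qed
    then obtain j where "\<not> prefix (\<omega> i) (\<omega> j)" using pf[OF i] by blast
    then show ?thesis by (cases "\<omega> i") auto
  qed
  have "concat (map \<omega> u) = concat (map \<omega> v) \<Longrightarrow> set u \<subseteq> {1..D} \<Longrightarrow> set v \<subseteq> {1..D} \<Longrightarrow> u = v" for u v
  proof (induction u arbitrary: v)
    case Nil
    then show ?case using ne by (cases v) auto
  next
    case (Cons a u)
    then obtain b v' where v: "v = b # v'" using ne by (cases v) auto
    have eq: "\<omega> a @ concat (map \<omega> u) = \<omega> b @ concat (map \<omega> v')" using Cons.prems v by simp
    then have "prefix (\<omega> a) (\<omega> b) \<or> prefix (\<omega> b) (\<omega> a)"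
      by (metis prefixI prefix_same_cases)
    then have "a = b" using pf[of a b] pf[of b a] Cons.prems v by auto
    then show ?case using Cons.IH[of v'] Cons.prems v eq by auto
  qed
  then show ?thesis unfolding uniquely_decodable_def inj_on_def lists_eq_set by blast
qed

section \<open>The length observable\<close>

text \<open>The length observable multiplies \<open>ket u\<close> by the length of \<open>u\<close>,
  so both sides are the same infinite sum, term by term.\<close>

lemma trace_length_obs:
  "trace_on UNIV (ketbra x x \<circ> length_obs) = ip x (\<lambda>w. of_nat (length w) * x w)"
proof -
  have "length_obs (ket u) = (\<lambda>w. of_nat (length w) * ket u w)" for u
  proof
    fix w
    have "length_obs (ket u) w =
        (\<Sum>\<^sub>\<infinity>k\<in>{length w}. of_nat k * fock_proj k (ket u) w)"
      unfolding length_obs_def by (rule infsum_cong_neutral) (auto simp: fock_proj_def)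
    then show "length_obs (ket u) w = of_nat (length w) * ket u w" by (simp add: fock_proj_def)
  qed
  \<comment> \<open>A sum over a singleton, the form in which \<open>ip_sum_right\<close> gives
    homogeneity.\<close>
  moreover have "(\<lambda>w. of_nat (length w) * ket u w) = (\<lambda>w. \<Sum>i\<in>{u}. of_nat (length u) * ket i w)"
    for u :: "bool list"
    by (auto simp: ket_def)
  ultimately have "ip x (length_obs (ket u)) = of_nat (length u) * cnj (x u)" for u
    by (simp only: ip_sum_right[OF finite.insertI[OF finite.emptyI] finite_supp_tpow[OF ket_tpow]])
      (simp add: ip_ket_right)
  then show ?thesis
    unfolding trace_on_def ip_ket unfolding ip_def by (simp add: ketbra_def mult_ac ip_def[symmetric])
qed

text \<open>Each \<open>\<phi> v\<close> is an eigenvector of the length observable with eigenvalue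
  \<open>L v\<close>, and orthonormality removes the cross terms.\<close>

lemma expected_length:
  fixes \<phi> :: "'i \<Rightarrow> bool ampl"
  assumes I: "finite I" and tp: "\<And>v. v \<in> I \<Longrightarrow> \<phi> v \<in> tpow (L v)" and on: "orthonormal_on I \<phi>"
  shows "Re (trace_on UNIV (ketbra (\<lambda>w. \<Sum>v\<in>I. a v * \<phi> v w) (\<lambda>w. \<Sum>v\<in>I. a v * \<phi> v w) \<circ> length_obs)) =
    (\<Sum>v\<in>I. (cmod (a v))\<^sup>2 * real (L v))"
proof -
  have len: "of_nat (length w) * (a v * \<phi> v w) = (a v * of_nat (L v)) * \<phi> v w" if "v \<in> I" for v w
    using tp[OF that] by (cases "length w = L v") (auto simp: tpow_def)
  have "(\<lambda>w. of_nat (length w) * (\<Sum>v\<in>I. a v * \<phi> v w)) = (\<lambda>w. \<Sum>v\<in>I. (a v * of_nat (L v)) * \<phi> v w)"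
    unfolding sum_distrib_left by (intro ext sum.cong refl len)
  moreover have "ip (\<lambda>w. \<Sum>v\<in>I. a v * \<phi> v w) (\<lambda>w. \<Sum>v\<in>I. (a v * of_nat (L v)) * \<phi> v w) =
      of_real (\<Sum>v\<in>I. (cmod (a v))\<^sup>2 * real (L v))"
  proof -
    have "ip (\<lambda>w. \<Sum>v\<in>I. a v * \<phi> v w) (\<lambda>w. \<Sum>v\<in>I. (a v * of_nat (L v)) * \<phi> v w) =
        (\<Sum>v\<in>I. cnj (a v) * (a v * of_nat (L v)))"
      by (rule ip_sum_orthonormal[OF I _ on]) (use tp finite_supp_tpow in blast)
    also have "\<dots> = of_real (\<Sum>v\<in>I. (cmod (a v))\<^sup>2 * real (L v))"
      by (simp add: cnj_mult_self flip: mult.assoc)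
    finally show ?thesis .
  qed
  ultimately show ?thesis by (simp only: trace_length_obs Re_complex_of_real)
qed

lemma prod_state_tpow: "prod_state s ns \<in> tpow (length ns)"
  by (simp add: tpow_def prod_state_def)

lemma prod_state_norm:
  fixes s :: "nat \<Rightarrow> complex ^ 'd"
  assumes "\<And>n. n \<in> set ns \<Longrightarrow> norm (s n) = 1"
  shows "ip (prod_state s ns) (prod_state s ns) = 1"
proof -
  have ip: "ip (prod_state s ns) (prod_state s ns) =
      (\<Sum>w | length w = length ns. cnj (prod_state s ns w) * prod_state s ns w)" for ns
    by (rule ip_finite[OF finite_words_length]) (simp add: prod_state_def)
  show ?thesis
    using assms
  proof (induction ns)
    case Nil
    then show ?case unfolding ip by (simp add: prod_state_def)
  next
    case (Cons n ns)
    let ?f = "prod_state s"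
    have c: "?f (n # ns) (a # w) = s n $ a * ?f ns w" for a w
      by (simp add: prod_state_def prod.lessThan_Suc_shift del: prod.lessThan_Suc)
    have "(\<Sum>a\<in>UNIV. (cmod (s n $ a))\<^sup>2) = (norm (s n))\<^sup>2"
      by (simp add: norm_vec_def L2_set_def sum_nonneg)
    also have "\<dots> = 1" using Cons.prems by simp
    finally have 1: "(\<Sum>a\<in>UNIV. cnj (s n $ a) * s n $ a) = 1"
      by (simp add: cnj_mult_self flip: of_real_sum of_real_power)
    \<comment> \<open>A nonempty word is a letter followed by a word, so the sum factors into the
      squared norms of the first state and of the rest.\<close>
    have "ip (?f (n # ns)) (?f (n # ns)) =
        (\<Sum>(a, w)\<in>UNIV \<times> {w. length w = length ns}. cnj (?f (n # ns) (a # w)) * ?f (n # ns) (a # w))"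
      unfolding ip
      by (rule sum.reindex_bij_witness[of _ "\<lambda>(a, w). a # w" "\<lambda>w. (hd w, tl w)"])
        (auto simp: length_Suc_conv)
    also have "\<dots> = (\<Sum>a\<in>UNIV. cnj (s n $ a) * s n $ a) * ip (?f ns) (?f ns)"
      unfolding ip c by (simp add: sum.cartesian_product[symmetric] sum_product mult_ac)
    finally show ?case using 1 Cons by simp
  qed
qed

lemma code_op_isometry:
  fixes e :: "nat \<Rightarrow> 'd::finite ampl"
  assumes e: "onb l D e" and \<psi>: "orthonormal_on {1..D} \<psi>" "\<And>i. i \<in> {1..D} \<Longrightarrow> finite (supp (\<psi> i))"
  shows "fock_isometry l (code_op D \<psi> e)"
proof -
  have op: "code_op D \<psi> e v = (\<lambda>w. \<Sum>i=1..D. ip (e i) v * \<psi> i w)" for v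
    by (simp add: code_op_def ketbra_def)
  have lin: "ip z (\<lambda>w. a * u w + b * v w) = a * ip z u + b * ip z v"
    if "u \<in> tpow l" "v \<in> tpow l" for a b and z u v :: "'d ampl"
  proof -
    \<comment> \<open>The two terms are indexed by the booleans to make them an instance of
      \<open>ip_sum_right\<close>.\<close>
    have "ip z (\<lambda>w. \<Sum>t\<in>UNIV. (if t then a else b) * (if t then u else v) w) =
        (\<Sum>t\<in>UNIV. (if t then a else b) * ip z (if t then u else v))"
      by (rule ip_sum_right) (use that finite_supp_tpow in auto)
    then show ?thesis by (simp add: UNIV_bool add.commute)
  qed
  have "ip (code_op D \<psi> e u) (code_op D \<psi> e v) = ip u v" if "u \<in> tpow l" "v \<in> tpow l" for u v
    unfolding op using ip_sum_orthonormal[OF _ \<psi>(2,1)] onb_parseval[OF e that] by simp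
  moreover have "code_op D \<psi> e v \<in> fock" for v
    unfolding op by (rule finite_supp_fock) (rule finite_supp_sum, use \<psi>(2) in auto)
  moreover have "linear_on_tpow l (code_op D \<psi> e)"
    unfolding linear_on_tpow_def op
    by (auto simp: lin algebra_simps sum.distrib sum_distrib_left)
  ultimately show ?thesis by (simp add: fock_isometry_def)
qed

lemma words_block:
  assumes "ns \<in> words N (m * l)" "k < m"
  shows "take (k * l) ns \<in> histories N m l" "take l (drop (k * l) ns) \<in> words N l"
proof -
  have "(k + 1) * l \<le> m * l" using assms(2) by (intro mult_right_mono) auto
  then have le: "k * l + l \<le> length ns" using assms(1) by (simp add: words_def)
  \<comment> \<open>Blocks are counted from 0 here and from 1 in \<open>histories\<close>, hence
    \<open>k + 1\<close>.\<close>
  have "take (k * l) ns \<in> words N ((k + 1 - 1) * l)"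
    using assms(1) le by (auto simp: words_def dest: in_set_takeD)
  then show "take (k * l) ns \<in> histories N m l"
    unfolding histories_def using assms(2) by (intro UN_I[of "k + 1"]) auto
  show "take l (drop (k * l) ns) \<in> words N l"
    using assms(1) le by (auto simp: words_def dest!: in_set_takeD in_set_dropD)
qed

lemma words_histories: "k < m \<Longrightarrow> h \<in> words N (k * l) \<Longrightarrow> h \<in> histories N m l"
  unfolding histories_def by (rule UN_I[of "k + 1"]) auto

text \<open>Once \<open>ns\<close> is fixed, so are all histories and their bases. The coefficient
  of a product of codewords is the product of the block amplitudes, so the squared moduli behave
  like the law of independent indices, and the expected lengths of the blocks add up.\<close>

lemma encoded_length:
  fixes s :: "nat \<Rightarrow> complex ^ 'd"
  assumes s: "\<And>n. n \<in> {1..N} \<Longrightarrow> norm (s n) = 1" and m: "m \<ge> 1"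
    and cw: "\<And>i. i \<in> {1..D} \<Longrightarrow> length_codeword (L i) (\<psi> i)"
    and jo: "jointly_orthonormal D \<psi>"
    and onb: "\<And>h. h \<in> histories N m l \<Longrightarrow> onb l D (e h)"
    and U: "\<And>h v. h \<in> histories N m l \<Longrightarrow> v \<in> tpow l \<Longrightarrow> U h v = code_op D \<psi> (e h) v"
    and ns: "ns \<in> words N (m * l)"
  shows "Re (trace_on UNIV (ketbra (encoded s m l U ns) (encoded s m l U ns) \<circ> length_obs)) =
    (\<Sum>k<m. \<Sum>i=1..D. (cmod (ip (e (take (k * l) ns) i)
       (prod_state s (take l (drop (k * l) ns)))))\<^sup>2 * real (L i))"
proof -
  define b where "b k = prod_state s (take l (drop (k * l) ns))" for k
  define c where "c k i = ip (e (take (k * l) ns) i) (b k)" for k i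
  have b: "b k \<in> tpow l" "ip (b k) (b k) = 1" if "k < m" for k
    using words_block(2)[OF ns that] prod_state_tpow[of s] prod_state_norm[of _ s] s
    unfolding b_def words_def by (metis (mono_tags, lifting) mem_Collect_eq, blast)
  have sum1: "(\<Sum>i=1..D. (cmod (c k i))\<^sup>2) = 1" if "k < m" for k
    unfolding c_def by (rule onb_norm[OF onb[OF words_block(1)[OF ns that]] b[OF that]])
  have "encoded s m l U ns = cats (map (\<lambda>k w. \<Sum>i=1..D. c k i * \<psi> i w) [0..<m])"
    unfolding encoded_def
  proof (rule arg_cong[where f = cats], rule map_cong[OF refl])
    fix k assume "k \<in> set [0..<m]"
    then have k: "k < m" by simp
    have "U (take (k * l) ns) (b k) = code_op D \<psi> (e (take (k * l) ns)) (b k)"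
      by (rule U[OF words_block(1)[OF ns k] b(1)[OF k]])
    then show "U (take (k * l) ns) (prod_state s (take l (drop (k * l) ns))) =
        (\<lambda>w. \<Sum>i=1..D. c k i * \<psi> i w)"
      by (simp add: b_def c_def code_op_def ketbra_def)
  qed
  also have "\<dots> = (\<lambda>w. \<Sum>v\<in>words D m. (\<Prod>k<m. c k (v ! k)) * cats (map \<psi> v) w)"
    unfolding cats_sum by (intro ext sum.cong arg_cong2[where f = "(*)"] prod.cong) auto
  finally have enc: "encoded s m l U ns =
      (\<lambda>w. \<Sum>v\<in>words D m. (\<Prod>k<m. c k (v ! k)) * cats (map \<psi> v) w)" .
  have "cats (map \<psi> v) \<in> tpow (sum_list (map L v))" if "v \<in> words D m" for v
  proof (rule cats_tpow)
    fix i assume "i \<in> set v"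
    then show "\<psi> i \<in> tpow (L i)" using cw[of i] that by (auto simp: words_def length_codeword_def)
  qed
  moreover have "orthonormal_on (words D m) (\<lambda>v. cats (map \<psi> v))"
    using jo m by (simp add: jointly_orthonormal_def)
  ultimately have "Re (trace_on UNIV (ketbra (encoded s m l U ns) (encoded s m l U ns) \<circ> length_obs)) =
      (\<Sum>v\<in>words D m. (cmod (\<Prod>k<m. c k (v ! k)))\<^sup>2 * real (sum_list (map L v)))"
    unfolding enc by (intro expected_length finite_words)
  also have "\<dots> = (\<Sum>v\<in>words D m. (\<Prod>k<m. (cmod (c k (v ! k)))\<^sup>2) * real (sum_list (map L v)))"
    by (simp add: prod_norm[symmetric] prod_power_distrib)
  also have "\<dots> = (\<Sum>k<m. \<Sum>i=1..D. (cmod (c k i))\<^sup>2 * real (L i))"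
    by (rule sum_words_prod_sum_list) (rule sum1)
  finally show ?thesis by (simp only: c_def b_def)
qed

text \<open>The contribution of block \<open>k\<close> depends only on the letters up to its end;
  the \<open>r\<close> later blocks are summed out by \<open>marg\<close>.\<close>

lemma sum_words_block:
  fixes p :: "nat list \<Rightarrow> real"
  assumes marg: "\<And>h q. (\<Sum>b\<in>words N q. p (h @ b)) = p h" and k: "k < m"
  shows "(\<Sum>ns\<in>words N (m * l). p ns * G (take (k * l) ns) (take l (drop (k * l) ns))) =
    (\<Sum>h\<in>words N (k * l). \<Sum>b\<in>words N l. p (h @ b) * G h b)"
proof -
  obtain r where "m = k + 1 + r" using k by (metis Suc_eq_plus1 Suc_leI le_Suc_ex)
  then have "m * l = k * l + (l + r * l)" by (simp add: algebra_simps)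
  then have "(\<Sum>ns\<in>words N (m * l). p ns * G (take (k * l) ns) (take l (drop (k * l) ns))) =
      (\<Sum>h\<in>words N (k * l). \<Sum>b\<in>words N l. \<Sum>t\<in>words N (r * l).
        p (h @ b @ t) * G (take (k * l) (h @ b @ t)) (take l (drop (k * l) (h @ b @ t))))"
    by (simp only: sum_words_add)
  also have "\<dots> = (\<Sum>h\<in>words N (k * l). \<Sum>b\<in>words N l. \<Sum>t\<in>words N (r * l). p (h @ b @ t) * G h b)"
    by (intro sum.cong refl) (auto simp: words_def)
  also have "\<dots> = (\<Sum>h\<in>words N (k * l). \<Sum>b\<in>words N l. p (h @ b) * G h b)"
    using marg[where h = "_ @ _"] by (simp flip: sum_distrib_right)
  finally show ?thesis .
qed

text \<open>With arbitrary bases \<open>e\<close> this serves both the lower bound for every code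
  and the value reached by eigenbases.\<close>

lemma avg_length_code:
  fixes s :: "nat \<Rightarrow> complex ^ 'd"
  assumes s: "\<And>n. n \<in> {1..N} \<Longrightarrow> norm (s n) = 1" and m: "m \<ge> 1"
    and marg: "\<And>h q. (\<Sum>b\<in>words N q. p (h @ b)) = p h"
    and cw: "\<And>i. i \<in> {1..D} \<Longrightarrow> length_codeword (L i) (\<psi> i)"
    and jo: "jointly_orthonormal D \<psi>"
    and onb: "\<And>h. h \<in> histories N m l \<Longrightarrow> onb l D (e h)"
    and U: "\<And>h v. h \<in> histories N m l \<Longrightarrow> v \<in> tpow l \<Longrightarrow> U h v = code_op D \<psi> (e h) v"
  shows "avg_length N s p m l U = (\<Sum>k<m. \<Sum>h\<in>words N (k * l). \<Sum>b\<in>words N l. p (h @ b) *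
    (\<Sum>i=1..D. (cmod (ip (e h i) (prod_state s b)))\<^sup>2 * real (L i)))"
proof -
  let ?G = "\<lambda>h b. \<Sum>i=1..D. (cmod (ip (e h i) (prod_state s b)))\<^sup>2 * real (L i)"
  have "avg_length N s p m l U = (\<Sum>ns\<in>words N (m * l). p ns *
      (\<Sum>k<m. ?G (take (k * l) ns) (take l (drop (k * l) ns))))"
    unfolding avg_length_def
    by (intro sum.cong refl arg_cong2[where f = "(*)"] encoded_length[OF s m cw jo onb U]) auto
  also have "\<dots> = (\<Sum>k<m. \<Sum>ns\<in>words N (m * l). p ns * ?G (take (k * l) ns) (take l (drop (k * l) ns)))"
    by (simp only: sum_distrib_left sum.swap[of _ "{..<m}"])
  also have "\<dots> = (\<Sum>k<m. \<Sum>h\<in>words N (k * l). \<Sum>b\<in>words N l. p (h @ b) * ?G h b)"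
    by (intro sum.cong refl sum_words_block marg) simp
  finally show ?thesis .
qed

section \<open>Conditional states\<close>

text \<open>The event described by \<open>h\<close> is the disjoint union of the events of its
  one-letter extensions.\<close>

lemma mass_marginal_1:
  assumes M: "prob_space M" and X: "\<And>t. t \<ge> 1 \<Longrightarrow> X t \<in> measurable M (count_space {1..N})"
  shows "(\<Sum>n=1..N. mass M X (h @ [n])) = mass M X h"
proof -
  interpret prob_space M by fact
  define A where "A h = {x \<in> space M. \<forall>i<length h. X (Suc i) x = h ! i}" for h
  have snoc: "A (h @ [n]) = A h \<inter> {x \<in> space M. X (Suc (length h)) x = n}" for h n
    by (auto simp: A_def nth_append less_Suc_eq)
  have "{x \<in> space M. X (Suc i) x = n} \<in> sets M" for i n
  proof -
    \<comment> \<open>Intersecting with the range gives a set of \<open>count_space {1..N}\<close>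
      for every \<open>n\<close>, also outside the range.\<close>
    have "X (Suc i) -` ({n} \<inter> {1..N}) \<inter> space M \<in> sets M"
      by (rule measurable_sets[OF X]) auto
    moreover have "X (Suc i) -` ({n} \<inter> {1..N}) \<inter> space M = {x \<in> space M. X (Suc i) x = n}"
      using measurable_space[OF X[of "Suc i"]] by auto
    ultimately show ?thesis by simp
  qed
  note X_sets = this
  have sets: "A h \<in> sets M" for h
    by (induction h rule: rev_induct) (auto simp: snoc intro: X_sets, simp add: A_def)
  have "A h = (\<Union>n\<in>{1..N}. A (h @ [n]))"
    unfolding snoc using measurable_space[OF X[of "Suc (length h)"]] by (auto simp: A_def)
  moreover have "measure M (\<Union>n\<in>{1..N}. A (h @ [n])) = (\<Sum>n=1..N. measure M (A (h @ [n])))"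
    by (rule finite_measure_finite_Union) (use sets in \<open>auto simp: disjoint_family_on_def snoc intro: X_sets\<close>)
  ultimately show ?thesis by (simp add: mass_def A_def)
qed

lemma mass_marginal:
  assumes "prob_space M" "\<And>t. t \<ge> 1 \<Longrightarrow> X t \<in> measurable M (count_space {1..N})"
  shows "(\<Sum>b\<in>words N q. mass M X (h @ b)) = mass M X h"
proof (induction q arbitrary: h)
  case (Suc q)
  have "(\<Sum>b\<in>words N q. mass M X (h @ n # b)) = mass M X (h @ [n])" for n
    using Suc.IH[of "h @ [n]"] by simp
  then show ?case by (simp only: sum_words_Suc mass_marginal_1[OF assms])
qed (simp add: words_0)

text \<open>Both sides are the quadratic form of the conditional state at \<open>x\<close>, once
  from its ensemble and once from its spectral decomposition.\<close>

lemma block_cond_state_eigen_mean: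
  fixes s :: "nat \<Rightarrow> complex ^ 'd"
  assumes eig: "eigensystem l D A lam f"
    and A: "\<And>v. v \<in> tpow l \<Longrightarrow> A v = block_cond_state N s p l h v"
    and x: "x \<in> tpow l"
  shows "(\<Sum>b\<in>words N l. p (h @ b) / p h * (cmod (ip x (prod_state s b)))\<^sup>2) =
    (\<Sum>j=1..D. (cmod (ip x (f j)))\<^sup>2 * lam j)"
proof -
  let ?s = "prod_state s" and ?q = "\<lambda>b. complex_of_real (p (h @ b) / p h)"
  have f: "onb l D f" "\<And>j. j \<in> {1..D} \<Longrightarrow> f j \<in> tpow l"
    "\<And>j. j \<in> {1..D} \<Longrightarrow> A (f j) = (\<lambda>w. of_real (lam j) * f j w)"
    using eig by (auto simp: eigensystem_def onb_def)
  have sb: "finite (supp (?s b))" for b by (rule finite_supp_tpow[OF prod_state_tpow])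
  have diag: "(\<Sum>b\<in>words N l. ?q b * ip (?s b) (f j) * ip x (?s b)) = of_real (lam j) * ip x (f j)"
    if j: "j \<in> {1..D}" for j
  proof -
    have "ip x (A (f j)) = ip x (\<lambda>w. \<Sum>b\<in>words N l. ?q b * ip (?s b) (f j) * ?s b w)"
      by (simp add: A[OF f(2)[OF j]] block_cond_state_def ketbra_def mult_ac)
    also have "\<dots> = (\<Sum>b\<in>words N l. ?q b * ip (?s b) (f j) * ip x (?s b))"
      by (rule ip_sum_right[OF finite_words sb])
    finally have "ip x (A (f j)) = (\<Sum>b\<in>words N l. ?q b * ip (?s b) (f j) * ip x (?s b))" .
    moreover have "ip x (A (f j)) = of_real (lam j) * ip x (f j)"
      unfolding f(3)[OF j] using ip_sum_right[of "{j}" f x "\<lambda>j. of_real (lam j)"]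
        finite_supp_tpow[OF f(2)[OF j]] by simp
    ultimately show ?thesis by simp
  qed
  \<comment> \<open>Only one of the two factors of the squared modulus is expanded in the
    eigenbasis; what remains are the sums evaluated in \<open>diag\<close>.\<close>
  have exp: "ip (?s b) x = (\<Sum>j=1..D. ip (f j) x * ip (?s b) (f j))" for b
  proof -
    have "ip (?s b) x = ip (?s b) (\<lambda>w. \<Sum>j=1..D. ip (f j) x * f j w)"
      using onb_expand[OF f(1) x] by simp
    also have "\<dots> = (\<Sum>j=1..D. ip (f j) x * ip (?s b) (f j))"
      by (rule ip_sum_right) (use f(2) finite_supp_tpow in blast)+
    finally show ?thesis .
  qed
  have sq: "ip y x * ip x y = of_real ((cmod (ip x y))\<^sup>2)" for y
    by (subst ip_cnj[symmetric]) (rule cnj_mult_self)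
  have "complex_of_real (\<Sum>b\<in>words N l. p (h @ b) / p h * (cmod (ip x (?s b)))\<^sup>2) =
      (\<Sum>b\<in>words N l. ?q b * (ip (?s b) x * ip x (?s b)))"
    by (simp add: sq)
  also have "\<dots> = (\<Sum>b\<in>words N l. \<Sum>j=1..D. ip (f j) x * (?q b * ip (?s b) (f j) * ip x (?s b)))"
    by (simp add: exp sum_distrib_left sum_distrib_right mult_ac)
  also have "\<dots> = (\<Sum>j=1..D. ip (f j) x * (\<Sum>b\<in>words N l. ?q b * ip (?s b) (f j) * ip x (?s b)))"
    by (subst sum.swap) (simp only: sum_distrib_left)
  also have "\<dots> = (\<Sum>j=1..D. ip (f j) x * ip x (f j) * of_real (lam j))"
    by (rule sum.cong[OF refl]) (simp only: diag, simp only: mult_ac)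
  also have "\<dots> = complex_of_real (\<Sum>j=1..D. (cmod (ip x (f j)))\<^sup>2 * lam j)"
    by (simp only: sq of_real_mult of_real_sum)
  finally show ?thesis by (simp only: of_real_eq_iff)
qed

lemma eigensystem_diag:
  assumes "eigensystem l D A lam f" "i \<in> {1..D}"
  shows "(\<Sum>j=1..D. (cmod (ip (f i) (f j)))\<^sup>2 * lam j) = lam i"
proof -
  have "(\<Sum>j=1..D. (cmod (ip (f i) (f j)))\<^sup>2 * lam j) = (\<Sum>j=1..D. if i = j then lam j else 0)"
    by (rule sum.cong) (use assms in \<open>auto simp: eigensystem_def onb_def orthonormal_on_def\<close>)
  then show ?thesis using assms(2) by simp
qed

text \<open>The separate summand is the term \<open>k = 0\<close>: the empty word is the only
  history of the first block and has probability 1.\<close>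

lemma length_functional_eq:
  assumes m: "m \<ge> 1" and p: "p [] = 1"
  shows "length_functional N p m l D lam ls =
    (\<Sum>k<m. \<Sum>h\<in>words N (k * l). p h * (\<Sum>i=1..D. lam h i * real (ls i)))"
proof -
  obtain r where r: "m = Suc r" using m by (cases m) auto
  let ?f = "\<lambda>k. \<Sum>h\<in>words N (k * l). p h * (\<Sum>i=1..D. lam h i * real (ls i))"
  have "(\<Sum>j=2..m. ?f (j - 1)) = (\<Sum>k<r. ?f (Suc k))"
    by (rule sum.reindex_bij_witness[of _ "\<lambda>k. k + 2" "\<lambda>j. j - 2"])
      (auto simp: r numeral_2_eq_2 Suc_diff_Suc simp flip: mult_Suc)
  then show ?thesis
    by (simp add: length_functional_def r sum.lessThan_Suc_shift words_0 p del: sum.lessThan_Suc)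
qed

theorem theorem2p18:
  fixes s :: "nat \<Rightarrow> complex ^ 'd"
    and M :: "'w measure"
    and X :: "nat \<Rightarrow> 'w \<Rightarrow> nat"
    and N m l d D :: nat
    and p :: "nat list \<Rightarrow> real"
    and R :: "nat list \<Rightarrow> 'd ampl \<Rightarrow> 'd ampl"
    and lam :: "nat list \<Rightarrow> nat \<Rightarrow> real"
    and e :: "nat list \<Rightarrow> nat \<Rightarrow> 'd ampl"
    and F :: "(nat \<Rightarrow> nat) \<Rightarrow> real"
    and V :: "(nat \<Rightarrow> bool list) \<Rightarrow> nat list \<Rightarrow> 'd ampl \<Rightarrow> bool ampl"
  assumes source: "quantum_source N s M X"
    and m: "m \<ge> 1" and l: "l \<ge> 1"
    and d_def: "d = CARD('d)" and D_def: "D = d ^ l"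
    and p_def: "p = mass M X"
    and states: "block_cond_states N s p m l R"
    and eigen: "\<forall>h\<in>histories N m l. eigensystem l D (R h) (lam h) (e h)"
    and F_def: "F = length_functional N p m l D lam"
    and V_def: "V = (\<lambda>\<omega> h. code_op D (\<lambda>i. ket (\<omega> i)) (e h))"
  shows "(\<forall>ls\<in>kraft_lengths D. 0 \<le> F ls) \<and>
         (\<exists>ls. is_arg_min F (\<lambda>ls. ls \<in> kraft_lengths D) ls) \<and>
         (\<forall>ls. is_arg_min F (\<lambda>ls. ls \<in> kraft_lengths D) ls \<longrightarrow> ILS N s p m l = F ls) \<and>
         (\<exists>U. is_arg_min (avg_length N s p m l) (special_block_code N m l) U \<and>
           avg_length N s p m l U = ILS N s p m l) \<and>
         (\<forall>ls. is_arg_min F (\<lambda>ls. ls \<in> kraft_lengths D) ls \<longrightarrow>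
           (\<exists>\<omega>. (\<forall>i\<in>{1..D}. length (\<omega> i) = ls i) \<and> (d \<ge> 2 \<longrightarrow> uniquely_decodable D \<omega>)) \<and>
           (\<forall>\<omega>. (\<forall>i\<in>{1..D}. length (\<omega> i) = ls i) \<and> (d \<ge> 2 \<longrightarrow> uniquely_decodable D \<omega>) \<longrightarrow>
              (\<forall>i\<in>{1..D}. length_codeword (ls i) (ket (\<omega> i))) \<and>
              jointly_orthonormal D (\<lambda>i. ket (\<omega> i)) \<and>
              special_block_code N m l (V \<omega>) \<and>
              avg_length N s p m l (V \<omega>) = F ls))"
proof -

  \<comment> \<open>The source, its marginals and the eigensystems\<close>
  let ?s = "prod_state s"
  have s: "norm (s n) = 1" if "n \<in> {1..N}" for n
    using source that by (simp add: quantum_source_def)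
  have M: "prob_space M" using source by (simp add: quantum_source_def)
  have X: "X t \<in> measurable M (count_space {1..N})" if "t \<ge> 1" for t
    using source that by (simp add: quantum_source_def)
  have marg: "(\<Sum>b\<in>words N q. p (h @ b)) = p h" for h q
    unfolding p_def by (rule mass_marginal[OF M X]) auto
  have p0: "0 \<le> p h" for h by (simp add: p_def mass_def)
  have pNil: "p [] = 1" using M by (simp add: p_def mass_Nil)
  have D: "D = CARD('d) ^ l" by (simp add: D_def d_def)
  have eig: "eigensystem l D (R h) (lam h) (e h)" and e: "onb l D (e h)"
    and lam: "antimono_on {1..D} (lam h)" if "h \<in> histories N m l" for h
    using eigen that by (auto simp: eigensystem_def)
  have R: "R h v = block_cond_state N s p l h v"
    if "h \<in> histories N m l" "p h \<noteq> 0" "v \<in> tpow l" for h v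
    using states that by (simp add: block_cond_states_def)

  have F: "F ls = (\<Sum>k<m. \<Sum>h\<in>words N (k * l). p h * (\<Sum>i=1..D. lam h i * real (ls i)))" for ls
    unfolding F_def by (rule length_functional_eq[where p = p, OF m pNil])

  \<comment> \<open>The average over the next block replaces squared amplitudes in a basis
    \<open>g\<close> by eigenvalues mixed with the overlaps of \<open>g\<close> and the
    eigenbasis.\<close>
  have mean: "(\<Sum>b\<in>words N l. p (h @ b) * (\<Sum>i=1..D. (cmod (ip (g i) (?s b)))\<^sup>2 * real (L i))) =
      p h * (\<Sum>i=1..D. (\<Sum>j=1..D. (cmod (ip (g i) (e h j)))\<^sup>2 * lam h j) * real (L i))"
    if h: "h \<in> histories N m l" and g: "\<And>i. i \<in> {1..D} \<Longrightarrow> g i \<in> tpow l" for h g and L :: "nat \<Rightarrow> nat"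
  proof (cases "p h = 0")
    case True
    \<comment> \<open>Extensions of a null history are null, so the arbitrary density operator
      assigned to it does not enter.\<close>
    then have "p (h @ b) = 0" if "b \<in> words N l" for b
      using marg[of h l] sum_nonneg_eq_0_iff[OF finite_words, of N l "\<lambda>b. p (h @ b)"] p0 that by auto
    then show ?thesis using True by simp
  next
    case False
    have "(\<Sum>b\<in>words N l. p (h @ b) * (\<Sum>i=1..D. (cmod (ip (g i) (?s b)))\<^sup>2 * real (L i))) =
        (\<Sum>b\<in>words N l. \<Sum>i=1..D. p h * (p (h @ b) / p h * (cmod (ip (g i) (?s b)))\<^sup>2 * real (L i)))"
      using False by (simp add: sum_distrib_left mult_ac)
    also have "\<dots> = p h * (\<Sum>i=1..D. (\<Sum>b\<in>words N l. p (h @ b) / p h * (cmod (ip (g i) (?s b)))\<^sup>2) * real (L i))"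
      by (subst sum.swap) (simp only: sum_distrib_left sum_distrib_right)
    also have "\<dots> = p h * (\<Sum>i=1..D. (\<Sum>j=1..D. (cmod (ip (g i) (e h j)))\<^sup>2 * lam h j) * real (L i))"
      by (intro arg_cong2[where f = "(*)"] sum.cong refl
          block_cond_state_eigen_mean[OF eig[OF h] R[OF h False] g])
    finally show ?thesis .
  qed

  \<comment> \<open>For \<open>p h \<noteq> 0\<close> the eigenvalue is a sum of squared overlaps
    with nonnegative weights; otherwise the factor \<open>p h\<close> vanishes.\<close>
  have lam0: "0 \<le> p h * lam h i" if h: "h \<in> histories N m l" and i: "i \<in> {1..D}" for h i
  proof (cases "p h = 0")
    case False
    have "e h i \<in> tpow l" using e[OF h] i by (simp add: onb_def)
    from block_cond_state_eigen_mean[OF eig[OF h] R[OF h False] this]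
    have "lam h i = (\<Sum>b\<in>words N l. p (h @ b) / p h * (cmod (ip (e h i) (?s b)))\<^sup>2)"
      by (simp only: eigensystem_diag[OF eig[OF h] i])
    also have "\<dots> \<ge> 0" by (intro sum_nonneg mult_nonneg_nonneg divide_nonneg_nonneg p0) auto
    finally show ?thesis using p0 by simp
  qed simp

  \<comment> \<open>The total weight of the \<open>i\<close>-th length over all histories:
    \<open>F\<close> is linear with nonnegative coefficients.\<close>
  define a where "a i = (\<Sum>k<m. \<Sum>h\<in>words N (k * l). p h * lam h i)" for i
  have a0: "0 \<le> a i" if "i \<in> {1..D}" for i
    unfolding a_def by (intro sum_nonneg lam0 that words_histories[of _ m]) auto
  have Fa: "F = (\<lambda>ls. \<Sum>i=1..D. a i * real (ls i))"
  proof
    fix ls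
    have "F ls = (\<Sum>k<m. \<Sum>h\<in>words N (k * l). \<Sum>i=1..D. p h * lam h i * real (ls i))"
      by (simp add: F sum_distrib_left mult.assoc)
    also have "\<dots> = (\<Sum>k<m. \<Sum>i=1..D. \<Sum>h\<in>words N (k * l). p h * lam h i * real (ls i))"
      by (intro sum.cong refl sum.swap)
    also have "\<dots> = (\<Sum>i=1..D. \<Sum>k<m. \<Sum>h\<in>words N (k * l). p h * lam h i * real (ls i))"
      by (rule sum.swap)
    finally show "F ls = (\<Sum>i=1..D. a i * real (ls i))"
      by (simp add: a_def sum_distrib_right)
  qed
  have F0: "0 \<le> F ls" for ls
    unfolding Fa by (intro sum_nonneg mult_nonneg_nonneg a0) auto

  \<comment> \<open>Lower bound for every special block code\<close>
  have lower: "\<exists>ls\<in>kraft_lengths D. F ls \<le> avg_length N s p m l U"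
    if U: "special_block_code N m l U" for U :: "nat list \<Rightarrow> 'd ampl \<Rightarrow> bool ampl"
  proof -
    obtain \<psi> g where cw: "\<forall>i\<in>{1..D}. \<exists>k. length_codeword k (\<psi> i)" and jo: "jointly_orthonormal D \<psi>"
      and g: "\<And>h. h \<in> histories N m l \<Longrightarrow> onb l D (g h)"
      and Ug: "\<And>h v. h \<in> histories N m l \<Longrightarrow> v \<in> tpow l \<Longrightarrow> U h v = code_op D \<psi> (g h) v"
      using U unfolding special_block_code_def D[symmetric] by blast
    from bchoice[OF cw] obtain L where L: "\<And>i. i \<in> {1..D} \<Longrightarrow> length_codeword (L i) (\<psi> i)" by blast
    \<comment> \<open>All histories share one sequence of codewords, so a single permutation sorts
      the lengths for all of them.\<close>
    obtain \<pi> where \<pi>: "bij_betw \<pi> {1..D} {1..D}" and mono: "mono_on {1..D} (\<lambda>i. L (\<pi> i))"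
      using ex_sorting by blast
    have \<pi>D: "\<pi> i \<in> {1..D}" if "i \<in> {1..D}" for i using \<pi> that by (rule bij_betwE[rule_format])
    have "(\<Sum>i=1..D. 1 / 2 ^ L (\<pi> i)) = (\<Sum>i=1..D. 1 / 2 ^ L i :: real)"
      by (rule sum.reindex_bij_betw[OF \<pi>])
    then have kraft: "(\<lambda>i. L (\<pi> i)) \<in> kraft_lengths D"
      using kraft_mcmillan_quantum[OF L jo] mono by (simp add: kraft_lengths_def)
    have block: "p h * (\<Sum>i=1..D. lam h i * real (L (\<pi> i))) \<le>
        (\<Sum>b\<in>words N l. p (h @ b) * (\<Sum>i=1..D. (cmod (ip (g h i) (?s b)))\<^sup>2 * real (L i)))"
      if h: "h \<in> histories N m l" for h
    proof -
      have gt: "g h i \<in> tpow l" "ip (g h i) (g h i) = 1" if "i \<in> {1..D}" for i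
        using g[OF h] that by (auto simp: onb_def orthonormal_on_def)
      have et: "e h i \<in> tpow l" "ip (e h i) (e h i) = 1" if "i \<in> {1..D}" for i
        using e[OF h] that by (auto simp: onb_def orthonormal_on_def)
      \<comment> \<open>Overlaps of two orthonormal bases: Parseval in either basis gives unit row
        and column sums, and permuting rows by \<open>\<pi>\<close> preserves them.\<close>
      let ?B = "\<lambda>i j. (cmod (ip (g h i) (e h j)))\<^sup>2"
      have rows: "(\<Sum>j=1..D. ?B i j) = 1" if "i \<in> {1..D}" for i
        using onb_norm[OF e[OF h] gt[OF that]]
        by (subst ip_cnj[symmetric]) (simp del: complex_cnj_cnj add: complex_mod_cnj)
      have cols: "(\<Sum>i=1..D. ?B (\<pi> i) j) = 1" if "j \<in> {1..D}" for j
        using onb_norm[OF g[OF h] et[OF that]] sum.reindex_bij_betw[OF \<pi>, of "\<lambda>i. ?B i j"] by simp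
      have "(\<Sum>i=1..D. lam h i * real (L (\<pi> i))) \<le>
          (\<Sum>i=1..D. (\<Sum>j=1..D. ?B (\<pi> i) j * lam h j) * real (L (\<pi> i)))"
        by (rule doubly_stochastic_rearrangement[OF lam[OF h]])
          (use mono rows \<pi>D cols in \<open>auto simp: monotone_on_def\<close>)
      also have "\<dots> = (\<Sum>i=1..D. (\<Sum>j=1..D. ?B i j * lam h j) * real (L i))"
        by (rule sum.reindex_bij_betw[OF \<pi>])
      finally have "p h * (\<Sum>i=1..D. lam h i * real (L (\<pi> i))) \<le>
          p h * (\<Sum>i=1..D. (\<Sum>j=1..D. ?B i j * lam h j) * real (L i))"
        by (rule mult_left_mono) (rule p0)
      then show ?thesis by (simp only: mean[where g = "g h", OF h gt(1)])
    qed
    have "F (\<lambda>i. L (\<pi> i)) \<le> avg_length N s p m l U"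
    proof -
      have "avg_length N s p m l U = (\<Sum>k<m. \<Sum>h\<in>words N (k * l). \<Sum>b\<in>words N l. p (h @ b) *
          (\<Sum>i=1..D. (cmod (ip (g h i) (?s b)))\<^sup>2 * real (L i)))"
        by (rule avg_length_code[OF s m marg L jo g Ug])
      then show ?thesis
        unfolding F by (simp only:) (intro sum_mono block, auto intro: words_histories)
    qed
    then show ?thesis using kraft by blast
  qed

  \<comment> \<open>Codes from classical bit strings and eigenbases\<close>
  have code: "(\<forall>i\<in>{1..D}. length_codeword (ls i) (ket (\<omega> i))) \<and>
      jointly_orthonormal D (\<lambda>i. ket (\<omega> i)) \<and> special_block_code N m l (V \<omega>) \<and>
      avg_length N s p m l (V \<omega>) = F ls"
    if len: "\<forall>i\<in>{1..D}. length (\<omega> i) = ls i" and ud: "d \<ge> 2 \<longrightarrow> uniquely_decodable D \<omega>" for ls \<omega>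
  proof -
    have cw: "length_codeword (ls i) (ket (\<omega> i))" if "i \<in> {1..D}" for i
      using len that ket_tpow[of "\<omega> i"] ip_ket[of "\<omega> i" "ket (\<omega> i)"]
      by (auto simp: length_codeword_def ket_def)
    \<comment> \<open>For \<open>d = 1\<close> there is a single codeword, which may be
      empty.\<close>
    have "d \<ge> 2 \<or> d = 1" using zero_less_card_finite[where 'a = 'd] unfolding d_def by linarith
    then have "D = 1 \<or> uniquely_decodable D \<omega>" using ud by (auto simp: D_def)
    then have jo: "jointly_orthonormal D (\<lambda>i. ket (\<omega> i))" by (rule jointly_orthonormal_ket)
    have "special_block_code N m l (V \<omega>)"
      unfolding special_block_code_def D[symmetric]
    proof (intro conjI ballI)
      fix h assume h: "h \<in> histories N m l"
      show "fock_isometry l (V \<omega> h)"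
        unfolding V_def
        by (rule code_op_isometry[OF e[OF h] jointly_orthonormal_1[OF jo] finite_supp_tpow[OF ket_tpow]])
    next
      show "\<exists>\<psi> g. (\<forall>i\<in>{1..D}. \<exists>k. length_codeword k (\<psi> i)) \<and> jointly_orthonormal D \<psi> \<and>
        (\<forall>h\<in>histories N m l. onb l D (g h) \<and> (\<forall>v\<in>tpow l. V \<omega> h v = code_op D \<psi> (g h) v))"
        unfolding V_def using cw jo e
        by (intro exI[of _ "\<lambda>i. ket (\<omega> i)"] exI[of _ e] conjI ballI refl exI[of _ "ls _"])
    qed
    moreover have "avg_length N s p m l (V \<omega>) = F ls"
    proof -
      have "avg_length N s p m l (V \<omega>) = (\<Sum>k<m. \<Sum>h\<in>words N (k * l). \<Sum>b\<in>words N l. p (h @ b) *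
          (\<Sum>i=1..D. (cmod (ip (e h i) (?s b)))\<^sup>2 * real (ls i)))"
        by (rule avg_length_code[OF s m marg cw jo e]) (auto simp: V_def)
      also have "\<dots> = F ls"
        unfolding F
      proof (intro sum.cong refl)
        fix k h assume "k \<in> {..<m}" "h \<in> words N (k * l)"
        then have h: "h \<in> histories N m l" by (auto intro: words_histories)
        have "e h i \<in> tpow l" if "i \<in> {1..D}" for i using e[OF h] that by (simp add: onb_def)
        \<comment> \<open>In the eigenbasis itself the overlap matrix is the identity, so the
          eigenvalues come out unmixed.\<close>
        from mean[where g = "e h", OF h this]
        show "(\<Sum>b\<in>words N l. p (h @ b) * (\<Sum>i=1..D. (cmod (ip (e h i) (?s b)))\<^sup>2 * real (ls i))) =
            p h * (\<Sum>i=1..D. lam h i * real (ls i))"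
          by (simp only: eigensystem_diag[OF eig[OF h]] cong: sum.cong)
      qed
      finally show ?thesis .
    qed
    ultimately show ?thesis using cw jo by blast
  qed

  have ex_code: "\<exists>\<omega> :: nat \<Rightarrow> bool list. (\<forall>i\<in>{1..D}. length (\<omega> i) = ls i) \<and> (d \<ge> 2 \<longrightarrow> uniquely_decodable D \<omega>)"
    if "ls \<in> kraft_lengths D" for ls
  proof -
    have "D \<ge> 2" if "d \<ge> 2" using self_le_power[of d l] that l by (simp add: D_def)
    then show ?thesis
      using kraft_prefix_code[OF that] prefix_free_uniquely_decodable[of D] by metis
  qed

  text \<open>
    Below the value \<open>B\<close> of a feasible point, lengths of positive weight are bounded and the others
    do not contribute, so only finitely many values occur.
  \<close>

  have ex_min: "\<exists>ls. is_arg_min F (\<lambda>ls. ls \<in> kraft_lengths D) ls"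
  proof -
    \<comment> \<open>Constant lengths \<open>D\<close> are feasible because
      \<open>D \<le> 2 ^ D\<close>.\<close>
    have const: "(\<lambda>_. D) \<in> kraft_lengths D"
      using less_exp[of D] by (simp add: kraft_lengths_def monotone_on_def divide_le_eq flip: of_nat_power)
    define B where "B = F (\<lambda>_. D)"
    define T where "T = {n \<in> kraft_lengths D. F n \<le> B}"
    \<comment> \<open>Division by 0 gives 0, so an index of weight 0 only adds the entry 0 to the
      maximum.\<close>
    define b where "b = Max ((\<lambda>i. nat \<lfloor>B / a i\<rfloor>) ` {1..D})"
    define P where "P = {g. \<forall>i. (i \<in> {1..D} \<longrightarrow> g i \<in> {..b}) \<and> (i \<notin> {1..D} \<longrightarrow> g i = 0)}"
    have "F n \<in> F ` P" if n: "n \<in> T" for n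
    proof (rule image_eqI)
      \<comment> \<open>Erasing the lengths of weight 0 may leave \<open>kraft_lengths\<close>, but
        it preserves the value of \<open>F\<close>, and \<open>P\<close> serves only to show that
        the values are finite in number.\<close>
      define g where "g i = (if i \<in> {1..D} \<and> a i \<noteq> 0 then n i else 0)" for i
      show "F n = F g" unfolding Fa by (rule sum.cong) (simp_all add: g_def)
      have "n i \<le> b" if i: "i \<in> {1..D}" "a i \<noteq> 0" for i
      proof -
        have "a i * real (n i) \<le> F n"
          unfolding Fa using member_le_sum[OF i(1), of "\<lambda>i. a i * real (n i)"] a0 by simp
        also have "\<dots> \<le> B" using n by (simp add: T_def)
        finally have "real (n i) \<le> B / a i"
          using a0[OF i(1)] i(2) by (simp add: pos_le_divide_eq mult.commute)
        then have "n i \<le> nat \<lfloor>B / a i\<rfloor>" by (rule le_nat_floor)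
        also have "\<dots> \<le> b" unfolding b_def using i(1) by (intro Max_ge) simp_all
        finally show ?thesis .
      qed
      then show "g \<in> P" by (simp add: P_def g_def)
    qed
    then have sub: "F ` T \<subseteq> F ` P" by blast
    have "finite P" unfolding P_def by (rule finite_set_of_finite_funs) simp_all
    then have fin: "finite (F ` T)" by (rule finite_subset[OF sub finite_imageI])
    have "F ` T \<noteq> {}" using const unfolding T_def B_def by blast
    from ex_min_if_finite[OF fin this] obtain n
      where n: "n \<in> T" "\<And>k. k \<in> T \<Longrightarrow> \<not> F k < F n" by blast
    have "F n \<le> F k" if k: "k \<in> kraft_lengths D" for k
    proof (cases "F k \<le> B")
      case True
      then have "k \<in> T" using k by (simp add: T_def)
      then show ?thesis using n(2) not_less by blast
    next
      case False
      then show ?thesis using n(1) by (simp add: T_def)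
    qed
    moreover have "n \<in> kraft_lengths D" using n(1) by (simp add: T_def)
    ultimately have "is_arg_min F (\<lambda>n. n \<in> kraft_lengths D) n" by (simp add: is_arg_min_linorder)
    then show ?thesis by blast
  qed

  \<comment> \<open>Equality of the infimum over codes and the minimum over lengths\<close>
  have opt: "F ls \<le> avg_length N s p m l U"
    if "is_arg_min F (\<lambda>ls. ls \<in> kraft_lengths D) ls" "special_block_code N m l U"
    for ls and U :: "nat list \<Rightarrow> 'd ampl \<Rightarrow> bool ampl"
    using lower[OF that(2)] that(1) unfolding is_arg_min_linorder by (meson order_trans)
  have attained: "\<exists>U :: nat list \<Rightarrow> 'd ampl \<Rightarrow> bool ampl.
      special_block_code N m l U \<and> avg_length N s p m l U = F ls"
    if "is_arg_min F (\<lambda>ls. ls \<in> kraft_lengths D) ls" for ls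
    using ex_code[of ls] code that unfolding is_arg_min_def by blast
  have ILS: "ILS N s p m l = F ls" if min: "is_arg_min F (\<lambda>ls. ls \<in> kraft_lengths D) ls" for ls
    unfolding ILS_def using attained[OF min] opt[OF min] by (intro cInf_eq_minimum) force+
  have "\<exists>U. is_arg_min (avg_length N s p m l) (special_block_code N m l) U \<and>
      avg_length N s p m l U = ILS N s p m l"
  proof -
    obtain ls where ls: "is_arg_min F (\<lambda>ls. ls \<in> kraft_lengths D) ls" using ex_min by blast
    then show ?thesis
      using attained[OF ls] opt[OF ls] ILS[OF ls] unfolding is_arg_min_linorder by metis
  qed
  moreover have "ls \<in> kraft_lengths D" if "is_arg_min F (\<lambda>ls. ls \<in> kraft_lengths D) ls" for ls
    using that by (simp add: is_arg_min_def)
  ultimately show ?thesis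
    using F0 ex_min ILS code ex_code by (intro conjI ballI allI impI) blast+
qed

end
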